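(* Let $\mathbb{K}\in\{\mathbb{R},\mathbb{C}\}$ be a field and $l\in\mathbb{N}$ an integer. Let $$\mathscr{C}_{\mathbb{K},l}=\Big\{d\in\mathscr{S}_{\mathbb{K}} : \sum_{j\in\mathbb{Z}}d_j=0\ \text{ and }\ \tau(d)\le l+1\Big\},$$ which is a finite dimensional $\mathbb{K}$-vector space. Then, for any Lebesgue measure on $\mathscr{C}_{\mathbb{K},l}$: (1) For almost all $d\in\mathscr{C}_{\mathbb{C},l}$, the sequence $(\mathbf{D}_N(d))_{N\ge1}$ is strongly stable. (2) For almost all $d\in\mathscr{C}_{\mathbb{R},l}$, the sequence $(\mathbf{D}_N(d))_{N\ge1}$ is stable relatively to any sequence $(\eta_N)_{N\ge1}$ of positive numbers such that $$\sum_{N\ge1}\frac{N+1}{\eta_N}<\infty\quad\text{and}\quad\sup_{N\ge1}\frac{(N+1)^2}{\eta_N}<\infty.$$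
   Context: $\mathbb{N}=\{0,1,2,\dots\}$; for $N\ge1$, $h=\frac1{N+1}$. A Lebesgue measure on a finite dimensional real or complex vector space is the image of Lebesgue measure under a linear identification with $\mathbb{R}^k$ (all have the same null sets). For $R\in\{\mathbb{R},\mathbb{C}\}$, $\mathscr{S}_R$ is the set of finitely supported $R$-valued sequences $b=(b_j)_{j\in\mathbb{Z}}$ with $b_j=b_{-j}$ for all $j$; $\tau(b)=\max\{j\in\mathbb{Z}:b_j\ne0\}$, with the convention $\tau(0)=-\infty$. The matrix $\mathbf{D}_N(d)$. For $d\in\mathscr{S}_{\mathbb{C}}$ let $T_d(w)=d\star w=\big(\sum_{j\in\mathbb{Z}}d_jw_{i-j}\big)_{i\in\mathbb{Z}}$ for $w\in\mathbb{C}^{\mathbb{Z}}$. Let $\mathscr{E}_N=\{w\in\mathbb{C}^{\mathbb{Z}}: w_{-j}=-w_j,\ w_{N+1+j}=-w_{N+1-j}\ \forall j\in\mathbb{Z}\}$, which is stable under $T_d$, with basis $\mathscr{B}_N=\big(\mathbb{1}_{j+(2N+2)\mathbb{Z}}-\mathbb{1}_{-j+(2N+2)\mathbb{Z}}\big)_{j=1,\dots,N}$. Then $\mathbf{D}_N(d)\in\mathbb{C}^{N\times N}$ is the matrix in the basis $\mathscr{B}_N$ of the restriction of $T_d$ to $\mathscr{E}_N$. Stability notions for a sequence $(\mathbf{D}_N)_{N\ge1}$, $\mathbf{D}_N\in\mathbb{C}^{N\times N}$, where $\|\mathbf{v}\|_\infty=\max_{1\le j\le N}|\mathbf{v}_j|$.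 It is strongly stable if for every $r\in\mathbb{N}$ there is $c>0$ such that for all $N\ge1$ and $\mathbf{v}\in\mathbb{C}^N$, $c\|\mathbf{v}\|_\infty\le\max_{1\le j\le N}\omega_j|(\mathbf{D}_N\mathbf{v})_j|$, where $\omega_j=h^{-2}$ if $r<j<N+1-r$ and $\omega_j=1$ otherwise. It is stable relatively to a sequence $(\eta_N)_{N\ge1}$ of positive numbers if there is $c>0$ such that for all $N\ge1$ and $\mathbf{v}\in\mathbb{C}^N$, $c\|\mathbf{v}\|_\infty\le\eta_N\|\mathbf{D}_N\mathbf{v}\|_\infty$.
   Formalization: In (2) the quantifiers are exchanged: for each admissible sequence (η_N), almost all d are stable relatively to it, the null set depending on (η_N); a single null set for all (η_N) is impossible, e.g. for l=1 by Khinchin's theorem. *)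

theory Defs
  imports
    "HOL-Analysis.Analysis"
    "HOL-Library.Function_Algebras"
    "Jordan_Normal_Form.Matrix"
begin

unbundle no vec_syntax


subsection \<open>Symmetric sequences\<close>

definition sym_seqs :: "(int \<Rightarrow> 'a::zero) set" where
  "sym_seqs = {b. finite {j. b j \<noteq> 0} \<and> (\<forall>j. b j = b (- j))}"

definition tau :: "(int \<Rightarrow> 'a::zero) \<Rightarrow> ereal" where
  "tau b = (if \<forall>j. b j = 0 then -\<infinity> else ereal (real_of_int (Max {j. b j \<noteq> 0})))"

definition coeff_space :: "nat \<Rightarrow> (int \<Rightarrow> 'a::comm_monoid_add) set" where
  "coeff_space l = {d \<in> sym_seqs. (\<Sum>j | d j \<noteq> 0. d j) = 0 \<and> tau d \<le> ereal (real l + 1)}"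

text \<open>Sequences with values in the field \<^typ>\<open>'a\<close> carry pointwise addition; scalar multiplication
  is passed explicitly to the constants of the locale \<^locale>\<open>module\<close>.\<close>

definition finite_dim_subspace :: "(int \<Rightarrow> 'a::field) set \<Rightarrow> bool" where
  "finite_dim_subspace V \<longleftrightarrow>
     module.subspace (\<lambda>c f j. c * f j) V \<and>
     (\<exists>B. finite B \<and> module.span (\<lambda>c f j. c * f j) B = V)"


subsection \<open>Lebesgue measures on a space of sequences\<close>

text \<open>The space \<open>\<real>\<^sup>k\<close> is modelled by the extensional functions on \<open>{..<k}\<close>, so that \<open>k\<close> may depend
  on the space \<open>V\<close>. Linearity is over the reals also for complex sequences.\<close>

definition linear_identification :: "nat \<Rightarrow> ((nat \<Rightarrow> real) \<Rightarrow> int \<Rightarrow> 'a::real_vector) \<Rightarrow> (int \<Rightarrow> 'a) set \<Rightarrow> bool"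
  where
  "linear_identification k \<phi> V \<longleftrightarrow>
     bij_betw \<phi> ({..<k} \<rightarrow>\<^sub>E UNIV) V \<and>
     (\<forall>x \<in> {..<k} \<rightarrow>\<^sub>E UNIV. \<forall>y \<in> {..<k} \<rightarrow>\<^sub>E UNIV. \<forall>a b. \<forall>j.
        \<phi> (\<lambda>i\<in>{..<k}. a * x i + b * y i) j = a *\<^sub>R \<phi> x j + b *\<^sub>R \<phi> y j)"

definition lebesgue_measures_on :: "(int \<Rightarrow> 'a::real_vector) set \<Rightarrow> (int \<Rightarrow> 'a) measure set" where
  "lebesgue_measures_on V =
     {embed_measure (completion (\<Pi>\<^sub>M i\<in>{..<k}. (lborel :: real measure))) \<phi> | k \<phi>.
        linear_identification k \<phi> V}"


subsection \<open>The matrices $D_N(d)$\<close>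

definition T_op :: "(int \<Rightarrow> complex) \<Rightarrow> (int \<Rightarrow> complex) \<Rightarrow> int \<Rightarrow> complex" where
  "T_op d w = (\<lambda>i. \<Sum>j | d j \<noteq> 0. d j * w (i - j))"

definition E_space :: "nat \<Rightarrow> (int \<Rightarrow> complex) set" where
  "E_space N = {w. \<forall>j. w (- j) = - w j \<and> w (int N + 1 + j) = - w (int N + 1 - j)}"

definition B_basis :: "nat \<Rightarrow> nat \<Rightarrow> int \<Rightarrow> complex" where
  "B_basis N j = (\<lambda>m.
     indicator {int j + (2 * int N + 2) * k | k. True} m
     - indicator {- int j + (2 * int N + 2) * k | k. True} m)"

text \<open>Vectors and matrices are indexed from 0: the basis vector \<open>B_basis N j\<close>, \<open>1 \<le> j \<le> N\<close>, has
  index \<open>j - 1\<close>. That the description below determines a unique matrix is \<open>ex1_D_mat\<close>.\<close>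

definition is_D_mat :: "nat \<Rightarrow> (int \<Rightarrow> complex) \<Rightarrow> complex mat \<Rightarrow> bool" where
  "is_D_mat N d A \<longleftrightarrow> A \<in> carrier_mat N N \<and>
     (\<forall>j\<in>{1..N}. \<forall>m. T_op d (B_basis N j) m = (\<Sum>i=1..N. A $$ (i - 1, j - 1) * B_basis N i m))"

definition D_mat :: "nat \<Rightarrow> (int \<Rightarrow> complex) \<Rightarrow> complex mat" where
  "D_mat N d = (THE A. is_D_mat N d A)"

lemma T_op_E_space:
  assumes d: "d \<in> sym_seqs" and w: "w \<in> E_space N"
  shows "T_op d w \<in> E_space N"
proof -
  let ?S = "{j. d j \<noteq> 0}"
  have dsym: "d (- j) = d j" for j using d by (simp add: sym_seqs_def)
  have w1: "w (- j) = - w j" and w2: "w (int N + 1 + j) = - w (int N + 1 - j)" for j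
    using w by (auto simp: E_space_def)
  have reidx: "(\<Sum>j\<in>?S. d j * g j) = (\<Sum>j\<in>?S. d j * g (- j))" for g :: "int \<Rightarrow> complex"
    by (rule sum.reindex_bij_witness[of _ uminus uminus]) (auto simp: dsym)
  show ?thesis
    unfolding E_space_def mem_Collect_eq
  proof (intro allI conjI)
    fix i
    have "T_op d w (- i) = (\<Sum>j\<in>?S. d j * w (- (i - j)))"
      unfolding T_op_def by (subst reidx) simp
    also have "\<dots> = - T_op d w i"
      by (simp only: T_op_def w1 mult_minus_right sum_negf)
    finally show "T_op d w (- i) = - T_op d w i" .
    have "T_op d w (int N + 1 + i) = (\<Sum>j\<in>?S. d j * w (int N + 1 + (i - j)))"
      unfolding T_op_def by (simp add: algebra_simps)
    also have "\<dots> = - (\<Sum>j\<in>?S. d j * w (int N + 1 - (i - j)))"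
      by (simp only: w2 mult_minus_right sum_negf)
    also have "\<dots> = - (\<Sum>j\<in>?S. d j * w (int N + 1 - i - j))"
      by (subst reidx) (simp add: algebra_simps)
    finally show "T_op d w (int N + 1 + i) = - T_op d w (int N + 1 - i)"
      by (simp add: T_op_def)
  qed
qed

lemma B_basis_alt:
  "B_basis N j m = of_bool (2 * int N + 2 dvd m - int j) - of_bool (2 * int N + 2 dvd m + int j)"
proof -
  have "m \<in> {a + (2 * int N + 2) * k | k. True} \<longleftrightarrow> 2 * int N + 2 dvd m - a" for a
    by (auto simp: dvd_def algebra_simps)
  from this[of "int j"] this[of "- int j"] show ?thesis
    by (simp add: B_basis_def indicator_def)
qed

lemma B_basis_in_E_space: "B_basis N j \<in> E_space N"
proof -
  let ?p = "2 * int N + 2"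
  have 1: "?p dvd - m - a \<longleftrightarrow> ?p dvd m + a" for m a
    using dvd_minus_iff[of ?p "m + a"] by simp
  have 2: "?p dvd int N + 1 + m - a \<longleftrightarrow> ?p dvd int N + 1 - m + a" for m a
  proof -
    have "?p dvd int N + 1 + m - a \<longleftrightarrow> ?p dvd ?p - (int N + 1 + m - a)"
      by (metis dvd_diff_commute dvd_minus_iff dvd_refl dvd_add_right_iff diff_conv_add_uminus)
    then show ?thesis by (simp add: algebra_simps)
  qed
  have 3: "?p dvd - m + a \<longleftrightarrow> ?p dvd m - a" for m a
    using 1[of m "- a"] by simp
  have 4: "?p dvd int N + 1 + m + a \<longleftrightarrow> ?p dvd int N + 1 - m - a" for m a
    using 2[of m "- a"] by simp
  show ?thesis
    unfolding E_space_def mem_Collect_eq B_basis_alt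
    by (simp only: 1 2 3 4) simp
qed

lemma B_basis_delta:
  assumes "i \<in> {1..N}" "j \<in> {1..N}"
  shows "B_basis N i (int j) = of_bool (i = j)"
proof -
  have "\<not> (2 * int N + 2 dvd int j + int i)"
    using assms by (auto dest!: zdvd_imp_le)
  moreover have "2 * int N + 2 dvd int j - int i \<longleftrightarrow> i = j"
  proof
    assume "2 * int N + 2 dvd int j - int i"
    then show "i = j"
      using assms dvd_imp_le_int[of "int j - int i" "2 * int N + 2"]
      by (cases "i \<le> j") auto
  qed simp
  ultimately show ?thesis by (simp add: B_basis_alt)
qed

lemma E_space_eqI:
  assumes v: "v \<in> E_space N" and w: "w \<in> E_space N"
    and eq: "\<And>j. j \<in> {1..N} \<Longrightarrow> v (int j) = w (int j)"
  shows "v = w"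
proof
  fix m
  let ?p = "2 * int N + 2"
  have zero: "u 0 = 0" "u (int N + 1) = 0" and odd: "u (- j) = - u j"
    and per: "u (j + ?p) = u j" if "u \<in> E_space N" for u j
  proof -
    have a: "\<And>j. u (- j) = - u j" "\<And>j. u (int N + 1 + j) = - u (int N + 1 - j)"
      using that by (auto simp: E_space_def)
    show "u 0 = 0" "u (int N + 1) = 0" using a(1)[of 0] a(2)[of 0] by simp_all
    show "u (- j) = - u j" by (rule a(1))
    have "u (j + ?p) = u (int N + 1 + (int N + 1 + j))" by (simp add: algebra_simps)
    also have "\<dots> = - u (- j)" by (subst a(2)) simp
    finally show "u (j + ?p) = u j" by (simp add: a(1))
  qed
  have perk: "u (j + ?p * int k) = u j" if "u \<in> E_space N" for u j k
  proof (induction k)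
    case (Suc k)
    have "u (j + ?p * int (Suc k)) = u ((j + ?p * int k) + ?p)" by (simp add: algebra_simps)
    also have "\<dots> = u j" by (simp only: per[OF that] Suc)
    finally show ?case .
  qed simp
  have permod: "u m = u (m mod ?p)" if u: "u \<in> E_space N" for u
  proof (cases "m div ?p \<ge> 0")
    case True
    then have "m = m mod ?p + ?p * int (nat (m div ?p))" by simp
    then show ?thesis using perk[OF u] by metis
  next
    case False
    then have "m + ?p * int (nat (- (m div ?p))) = m mod ?p"
      by (simp add: minus_mult_div_eq_mod[symmetric])
    then show ?thesis using perk[OF u] by metis
  qed
  define r where "r = m mod ?p"
  have r: "0 \<le> r" "r < ?p" by (simp_all add: r_def)
  have "v r = w r"
  proof -
    consider "r = 0" | "1 \<le> r" "r \<le> int N" | "r = int N + 1" | "int N + 2 \<le> r" using r by linarith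
    then show ?thesis
    proof cases
      case 1 then show ?thesis by (simp add: zero v w)
    next
      case 2
      then have "nat r \<in> {1..N}" by (simp add: nat_le_iff le_nat_iff)
      from eq[OF this] show ?thesis using 2 by simp
    next
      case 3 then show ?thesis by (simp add: zero v w)
    next
      case 4
      have "u r = - u (int (nat (?p - r)))" if u: "u \<in> E_space N" for u
        using per[OF u, of "- (?p - r)"] odd[OF u, of "?p - r"] r by simp
      moreover have "nat (?p - r) \<in> {1..N}" using 4 r by (simp add: nat_le_iff le_nat_iff)
      ultimately show ?thesis using eq v w by metis
    qed
  qed
  then show "v m = w m" by (simp add: permod v w r_def)
qed

lemma E_space_expand:
  assumes w: "w \<in> E_space N"
  shows "w = (\<lambda>m. \<Sum>i=1..N. w (int i) * B_basis N i m)"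
proof (rule E_space_eqI[OF w])
  have "B_basis N i (- m) = - B_basis N i m"
    "B_basis N i (int N + 1 + m) = - B_basis N i (int N + 1 - m)" for i m
    using B_basis_in_E_space[of N i] by (auto simp: E_space_def)
  then show "(\<lambda>m. \<Sum>i=1..N. w (int i) * B_basis N i m) \<in> E_space N"
    unfolding E_space_def mem_Collect_eq by (simp only: mult_minus_right sum_negf) simp
  fix j assume j: "j \<in> {1..N}"
  have "(\<Sum>i=1..N. w (int i) * B_basis N i (int j)) = (\<Sum>i=1..N. if i = j then w (int i) else 0)"
    using j by (intro sum.cong) (auto simp: B_basis_delta)
  then show "w (int j) = (\<Sum>i=1..N. w (int i) * B_basis N i (int j))"
    using j by simp
qed

lemma ex1_D_mat:
  assumes d: "d \<in> sym_seqs"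
  shows "\<exists>!A. is_D_mat N d A"
proof
  let ?A = "mat N N (\<lambda>(i, j). T_op d (B_basis N (Suc j)) (int (Suc i)))"
  show "is_D_mat N d ?A"
    unfolding is_D_mat_def
  proof (intro conjI ballI allI)
    fix j m assume j: "j \<in> {1..N}"
    have "T_op d (B_basis N j) m = (\<Sum>i=1..N. T_op d (B_basis N j) (int i) * B_basis N i m)"
      by (rule fun_cong[OF E_space_expand[OF T_op_E_space[OF d B_basis_in_E_space]]])
    also have "\<dots> = (\<Sum>i=1..N. ?A $$ (i - 1, j - 1) * B_basis N i m)"
      using j by (intro sum.cong) auto
    finally show "T_op d (B_basis N j) m = (\<Sum>i=1..N. ?A $$ (i - 1, j - 1) * B_basis N i m)" .
  qed simp
  fix A assume A: "is_D_mat N d A"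
  have entry: "A $$ (i - 1, j - 1) = T_op d (B_basis N j) (int i)"
    if i: "i \<in> {1..N}" and j: "j \<in> {1..N}" for i j
  proof -
    have "T_op d (B_basis N j) (int i) = (\<Sum>k=1..N. A $$ (k - 1, j - 1) * B_basis N k (int i))"
      using A j by (simp add: is_D_mat_def)
    also have "\<dots> = (\<Sum>k=1..N. if k = i then A $$ (k - 1, j - 1) else 0)"
      using i by (intro sum.cong) (auto simp: B_basis_delta)
    finally show ?thesis using i by simp
  qed
  show "A = ?A"
  proof (rule eq_matI)
    fix i j assume "i < dim_row ?A" "j < dim_col ?A"
    then show "A $$ (i, j) = ?A $$ (i, j)"
      using entry[of "Suc i" "Suc j"] by simp
  qed (use A in \<open>auto simp: is_D_mat_def\<close>)
qed


subsection \<open>Stability\<close>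

definition vec_norm_inf :: "complex vec \<Rightarrow> real" where
  "vec_norm_inf v = Max ((\<lambda>i. cmod (v $ i)) ` {..<dim_vec v})"

definition mesh :: "nat \<Rightarrow> real" where
  "mesh N = 1 / (real N + 1)"

text \<open>The condition \<open>j + r < N + 1\<close> expresses \<open>j < N + 1 - r\<close> without truncated subtraction.\<close>

definition weight :: "nat \<Rightarrow> nat \<Rightarrow> nat \<Rightarrow> real" where
  "weight r N j = (if r < j \<and> j + r < N + 1 then 1 / (mesh N)\<^sup>2 else 1)"

definition strongly_stable :: "(nat \<Rightarrow> complex mat) \<Rightarrow> bool" where
  "strongly_stable D \<longleftrightarrow>
     (\<forall>r::nat. \<exists>c>0. \<forall>N\<ge>1. \<forall>v\<in>carrier_vec N.
        c * vec_norm_inf v \<le> Max ((\<lambda>j. weight r N j * cmod ((D N *\<^sub>v v) $ (j - 1))) ` {1..N}))"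

definition stable_relatively :: "(nat \<Rightarrow> complex mat) \<Rightarrow> (nat \<Rightarrow> real) \<Rightarrow> bool" where
  "stable_relatively D \<eta> \<longleftrightarrow>
     (\<exists>c>0. \<forall>N\<ge>1. \<forall>v\<in>carrier_vec N. c * vec_norm_inf v \<le> \<eta> N * vec_norm_inf (D N *\<^sub>v v))"

end

theory Submission
  imports
    Defs
    "HOL-Computational_Algebra.Fundamental_Theorem_Algebra"
    "HOL-Library.Periodic_Fun"
begin

text \<open>
  Let \<open>L = lap\<close> be the discrete Laplacian on sequences. A symmetric finitely supported \<open>d\<close> acts by
  convolution as \<open>p(L)\<close> for a polynomial \<open>p = symbol l d\<close>, because the sum of the shifts by \<open>j\<close> and
  \<open>-j\<close> is a Chebyshev type polynomial in \<open>L\<close>. The condition \<open>\<Sum> d_j = 0\<close> says \<open>p(0) = 0\<close>, so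
  \<open>p = x q(x)\<close>. On the odd periodic sequences \<open>E_space N\<close> the eigenvalues of \<open>L\<close> lie in \<open>(0,4)\<close>, and
  \<open>D_mat N d\<close> is \<open>p(L)\<close> there. Hence stability is governed by how the roots of \<open>p\<close> sit
  with respect to \<open>[0,4]\<close>, and the operators \<open>L - \<alpha>\<close> belonging to them are inverted one by one, in the
  maximum norm.

  Complex case. Generically \<open>q\<close> has no root in \<open>[0,4]\<close> (\<open>lower_bound_strong\<close>). For \<open>\<alpha>\<close> outside
  \<open>[0,4]\<close> write \<open>2 - \<alpha> = z + 1/z\<close> with \<open>\<bar>z\<bar> < 1\<close>; then \<open>L - \<alpha>\<close> is \<open>1/z\<close> times the product of
  \<open>1 - zS\<close> and \<open>1 - z/S\<close>, \<open>S\<close> being the shift, and both factors are boundedly invertible with respect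
  to every weight that varies at most by a factor \<open>1/\<rho>\<close> from one point to the next, \<open>\<bar>z\<bar> < \<rho>\<close>. With the
  weight \<open>h^2 + \<rho>^dist\<close>, where \<open>dist\<close> is the distance to the boundary points, \<open>q(L)\<close> is thus
  inverted without destroying the good right hand side in the interior. The
  remaining factor \<open>L\<close> is inverted by comparison with an explicit function that stays bounded
  independently of \<open>N\<close>: the contribution of \<open>h^2\<close> is a parabola of height at most 1/2, that of
  the boundary layers is \<open>K (1 - \<rho>^j)\<close> and its mirror image.

  Real case. The polynomial \<open>p\<close> may have roots in \<open>(0,4)\<close>, but generically all roots are simple and
  differ from 4 (\<open>lower_bound_simple_roots\<close>). By partial fractions the inverse of \<open>p(L)\<close> is a
  combination of the inverses of the \<open>L - \<alpha>\<close>. These are bounded by a constant for \<open>\<alpha>\<close> outside \<open>[0,4]\<close>,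
  by \<open>(N+1)^2\<close> for \<open>\<alpha> = 0\<close>, and by a multiple of \<open>(N+1) / \<bar>sin ((N+1)\<theta>)\<bar>\<close> for
  \<open>\<alpha> = 2 - 2 cos \<theta>\<close>. Since \<open>\<Sum> (N+1)/\<eta>_N\<close> converges, Borel--Cantelli shows that for almost every \<open>\<theta>\<close>
  the last bound is \<open>O(\<eta>_N)\<close> (\<open>negligible_not_badly_approximable\<close>).

  Almost all. The second difference sequence \<open>lap_seq\<close> has symbol \<open>x\<close>, so adding \<open>t\<close> times it to \<open>d\<close>
  replaces \<open>q\<close> by \<open>q + t\<close>. For fixed \<open>d\<close> the exceptional \<open>t\<close> are values of \<open>- q\<close>: on the segment \<open>[0,4]\<close>,
  which is a smooth curve and therefore null in the plane, in the complex case; on a finite set and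
  on a null set of angles \<open>\<theta>\<close> in the real case. The good set is measurable, and a Fubini argument
  along translates (\<open>AE_lborel_power_by_translates\<close>) turns this into a statement
  about almost all \<open>d\<close>.
\<close>

section \<open>Symmetric sequences as polynomials in the discrete Laplacian\<close>

definition lap :: "(int \<Rightarrow> complex) \<Rightarrow> int \<Rightarrow> complex" where
  "lap w i = 2 * w i - w (i - 1) - w (i + 1)"

text \<open>The operator \<open>p(L)\<close>, evaluated by Horner's scheme.\<close>
definition poly_lap :: "complex poly \<Rightarrow> (int \<Rightarrow> complex) \<Rightarrow> int \<Rightarrow> complex" where
  "poly_lap p w = fold_coeffs (\<lambda>a u i. a * w i + lap u i) p (\<lambda>_. 0)"

lemma poly_lap_0 [simp]: "poly_lap 0 w i = 0"
  by (simp add: poly_lap_def)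

lemma poly_lap_pCons: "poly_lap (pCons a p) w i = a * w i + lap (poly_lap p w) i"
proof (cases "a = 0 \<and> p = 0")
  case True
  then show ?thesis by (simp add: poly_lap_def lap_def)
next
  case False
  then have "fold_coeffs f (pCons a p) = f a \<circ> fold_coeffs f p" for f :: "complex \<Rightarrow> (int \<Rightarrow> complex) \<Rightarrow> _"
    by auto
  then show ?thesis by (simp add: poly_lap_def)
qed

lemma lap_linear: "lap (\<lambda>i. a * u i + b * v i) i = a * lap u i + b * lap v i"
  by (simp add: lap_def algebra_simps)

lemma lap_poly_lap: "lap (poly_lap p w) i = poly_lap p (lap w) i"
proof (induction p arbitrary: i)
  case 0
  then show ?case by (simp add: lap_def)
next
  case (pCons a p)
  have "lap (poly_lap p w) = poly_lap p (lap w)" using pCons.IH by blast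
  then show ?case
    using lap_linear[of a w 1 "lap (poly_lap p w)" i] poly_lap_pCons[of a p w, abs_def]
    by (simp add: poly_lap_pCons)
qed

lemma poly_lap_add: "poly_lap (p + q) w i = poly_lap p w i + poly_lap q w i"
proof (induction p q arbitrary: i rule: poly_induct2)
  case (pCons a p b q)
  have "poly_lap (p + q) w = (\<lambda>i. poly_lap p w i + poly_lap q w i)" using pCons.IH by blast
  then show ?case by (simp add: poly_lap_pCons lap_def algebra_simps)
qed simp

lemma poly_lap_smult: "poly_lap (Polynomial.smult c p) w i = c * poly_lap p w i"
proof (induction p arbitrary: i)
  case (pCons a p)
  have "poly_lap (Polynomial.smult c p) w = (\<lambda>i. c * poly_lap p w i)" using pCons.IH by blast
  then show ?case by (simp add: poly_lap_pCons lap_def algebra_simps)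
qed simp

lemma poly_lap_sum: "poly_lap (\<Sum>x\<in>S. f x) w i = (\<Sum>x\<in>S. poly_lap (f x) w i)"
  by (induction S rule: infinite_finite_induct) (simp_all add: poly_lap_add)

text \<open>Products of polynomials become compositions. This is what allows \<open>p(L)\<close> to be inverted root by
  root.\<close>
lemma poly_lap_mult: "poly_lap (p * q) w i = poly_lap p (poly_lap q w) i"
proof (induction p arbitrary: i)
  case (pCons a p)
  have "poly_lap (p * q) w = poly_lap p (poly_lap q w)" using pCons.IH by blast
  then show ?case by (simp add: poly_lap_add poly_lap_smult poly_lap_pCons)
qed simp

lemma poly_lap_1 [simp]: "poly_lap 1 w i = w i"
  by (simp add: one_pCons poly_lap_pCons lap_def)

lemma poly_lap_linear: "poly_lap [:a, 1:] w i = a * w i + lap w i"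
proof -
  have "poly_lap [:1:] w = w" by (rule ext) (simp add: poly_lap_pCons lap_def)
  then show ?thesis by (simp add: poly_lap_pCons)
qed

lemma lap_E_space: "w \<in> E_space N \<Longrightarrow> lap w \<in> E_space N"
proof -
  assume w: "w \<in> E_space N"
  have a: "w (- j) = - w j" and b: "w (int N + 1 + j) = - w (int N + 1 - j)" for j
    using w by (auto simp: E_space_def)
  have "lap w (- j) = - lap w j" for j
    using a[of j] a[of "j + 1"] a[of "j - 1"] unfolding lap_def
    by (simp add: diff_diff_eq[symmetric] add.commute[of 1])
  moreover have "lap w (int N + 1 + j) = - lap w (int N + 1 - j)" for j
    using b[of j] b[of "j + 1"] b[of "j - 1"] by (simp add: lap_def algebra_simps)
  ultimately show "lap w \<in> E_space N" by (simp add: E_space_def)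
qed

lemma E_space_linear:
  "u \<in> E_space N \<Longrightarrow> v \<in> E_space N \<Longrightarrow> (\<lambda>i. a * u i + b * v i) \<in> E_space N"
  unfolding E_space_def mem_Collect_eq by (auto simp: algebra_simps)

lemma poly_lap_E_space:
  assumes w: "w \<in> E_space N"
  shows "poly_lap p w \<in> E_space N"
proof (induction p)
  case 0
  then show ?case by (simp add: E_space_def)
next
  case (pCons a p)
  have "poly_lap (pCons a p) w = (\<lambda>i. a * w i + 1 * lap (poly_lap p w) i)"
    by (rule ext) (simp add: poly_lap_pCons)
  then show ?case using E_space_linear[OF w lap_E_space[OF pCons.IH], of a 1] by simp
qed

text \<open>The recursion is the one of the Chebyshev polynomials, written in the variable \<open>x = 2 - 2 cos \<theta>\<close>:
  \<open>shift_poly n\<close> is the polynomial whose value at that point is \<open>2 cos (n \<theta>)\<close>.\<close>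
fun shift_poly :: "nat \<Rightarrow> complex poly" where
  "shift_poly 0 = [:2:]"
| "shift_poly (Suc 0) = [:2, -1:]"
| "shift_poly (Suc (Suc n)) = [:2, -1:] * shift_poly (Suc n) - shift_poly n"

lemma poly_lap_shift_poly: "poly_lap (shift_poly n) w i = w (i - int n) + w (i + int n)"
proof (induction n arbitrary: i rule: shift_poly.induct)
  case 1
  then show ?case by (simp add: poly_lap_pCons lap_def)
next
  case 2
  have "poly_lap [:-1:] w = (\<lambda>i. - w i)" by (rule ext) (simp add: poly_lap_pCons lap_def)
  then show ?case by (simp add: poly_lap_pCons lap_def)
next
  case (3 n)
  have e: "poly_lap [:-1:] u = (\<lambda>i. - u i)" for u by (rule ext) (simp add: poly_lap_pCons lap_def)
  have f: "poly_lap [:2, -1:] u j = u (j - 1) + u (j + 1)" for u j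
    by (simp add: poly_lap_pCons e) (simp add: lap_def)
  have sp: "shift_poly (Suc (Suc n)) = [:2, -1:] * shift_poly (Suc n) + Polynomial.smult (-1) (shift_poly n)" by simp
  have "poly_lap (shift_poly (Suc (Suc n))) w i
    = poly_lap [:2, -1:] (poly_lap (shift_poly (Suc n)) w) i - poly_lap (shift_poly n) w i"
    by (subst sp, subst poly_lap_add, subst poly_lap_mult, subst poly_lap_smult) simp
  then show ?case by (simp add: f 3 algebra_simps)
qed

lemma poly_shift_poly_0: "poly (shift_poly n) 0 = 2"
  by (induction n rule: shift_poly.induct) auto

text \<open>The Fourier symbol \<open>\<Sum> d_j e^(ij\<theta>)\<close> of \<open>d\<close>, as a polynomial in \<open>2 - 2 cos \<theta>\<close>.\<close>
definition symbol :: "nat \<Rightarrow> (int \<Rightarrow> complex) \<Rightarrow> complex poly" where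
  "symbol l d = [:d 0:] + (\<Sum>j=1..Suc l. Polynomial.smult (d (int j)) (shift_poly j))"

lemma sum_symmetric_interval:
  fixes f :: "int \<Rightarrow> 'a::comm_monoid_add"
  shows "(\<Sum>j\<in>{- int n..int n}. f j) = f 0 + (\<Sum>j=1..n. f (int j) + f (- int j))"
proof (induction n)
  case (Suc n)
  have "{- int (Suc n)..int (Suc n)} = insert (int (Suc n)) (insert (- int (Suc n)) {- int n..int n})"
    by auto
  then show ?case using Suc by (simp add: add_ac)
qed simp

lemma mem_coeff_space_iff:
  "d \<in> coeff_space l \<longleftrightarrow> (\<forall>j. d (- j) = d j) \<and> (\<forall>j>int (Suc l). d j = 0) \<and>
     (\<Sum>j\<in>{- int (Suc l)..int (Suc l)}. d j) = 0"
  (is "?L \<longleftrightarrow> ?S \<and> ?T \<and> ?Z")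
proof -
  have supp: "{j. d j \<noteq> 0} \<subseteq> {- int (Suc l)..int (Suc l)}" if s: ?S and t: ?T
  proof
    fix j assume "j \<in> {j. d j \<noteq> 0}"
    then have "d j \<noteq> 0" "d (- j) \<noteq> 0" using s by auto
    then have "\<not> j > int (Suc l)" "\<not> - j > int (Suc l)" using t by blast+
    then show "j \<in> {- int (Suc l)..int (Suc l)}" by auto
  qed
  have sums: "(\<Sum>j | d j \<noteq> 0. d j) = (\<Sum>j\<in>{- int (Suc l)..int (Suc l)}. d j)" if ?S ?T
    by (rule sum.mono_neutral_left) (use supp[OF that] in auto)
  have tau: "tau d \<le> ereal (real l + 1) \<longleftrightarrow> ?T" if fin: "finite {j. d j \<noteq> 0}"
  proof (cases "\<forall>j. d j = 0")
    case True
    then show ?thesis by (simp add: tau_def)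
  next
    case False
    then have ne: "{j. d j \<noteq> 0} \<noteq> {}" by auto
    have "tau d \<le> ereal (real l + 1) \<longleftrightarrow> Max {j. d j \<noteq> 0} \<le> int (Suc l)"
      using False by (auto simp: tau_def)
    also have "\<dots> \<longleftrightarrow> (\<forall>j\<in>{j. d j \<noteq> 0}. j \<le> int (Suc l))"
      using fin ne by (simp add: Max_le_iff)
    also have "\<dots> \<longleftrightarrow> ?T" by force
    finally show ?thesis .
  qed
  show ?thesis
  proof
    assume L: ?L
    then have S: ?S and fin: "finite {j. d j \<noteq> 0}" and Z: "(\<Sum>j | d j \<noteq> 0. d j) = 0"
      by (auto simp: coeff_space_def sym_seqs_def)
    then show "?S \<and> ?T \<and> ?Z" using L tau[OF fin] sums by (auto simp: coeff_space_def)
  next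
    assume R: "?S \<and> ?T \<and> ?Z"
    then have fin: "finite {j. d j \<noteq> 0}" using finite_subset[OF supp] by simp
    show ?L using R fin tau[OF fin] sums by (auto simp: coeff_space_def sym_seqs_def)
  qed
qed

lemma coeff_space_support:
  assumes "d \<in> coeff_space l"
  shows "{j. d j \<noteq> 0} \<subseteq> {- int (Suc l)..int (Suc l)}"
proof
  fix j assume "j \<in> {j. d j \<noteq> 0}"
  moreover have s: "\<forall>j. d (- j) = d j" and t: "\<forall>j>int (Suc l). d j = 0"
    using assms by (auto simp: mem_coeff_space_iff)
  ultimately have "d j \<noteq> 0" "d (- j) \<noteq> 0" by auto
  then have "\<not> j > int (Suc l)" "\<not> - j > int (Suc l)" using t by blast+
  then show "j \<in> {- int (Suc l)..int (Suc l)}" by auto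
qed

lemma T_op_interval:
  assumes "d \<in> coeff_space l"
  shows "T_op d w i = (\<Sum>j\<in>{- int (Suc l)..int (Suc l)}. d j * w (i - j))"
  unfolding T_op_def
  by (rule sum.mono_neutral_left) (use coeff_space_support[OF assms] in auto)

lemma T_op_eq_poly_lap:
  assumes d: "d \<in> coeff_space l"
  shows "T_op d w = poly_lap (symbol l d) w"
proof
  fix i
  have s: "d (- j) = d j" for j using d by (auto simp: mem_coeff_space_iff)
  have "T_op d w i = d 0 * w i + (\<Sum>j=1..Suc l. d (int j) * (w (i - int j) + w (i + int j)))"
    unfolding T_op_interval[OF d] sum_symmetric_interval by (simp add: s algebra_simps)
  also have "\<dots> = poly_lap (symbol l d) w i"
    unfolding symbol_def poly_lap_add poly_lap_sum poly_lap_smult poly_lap_shift_poly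
    by (simp add: poly_lap_pCons lap_def)
  finally show "T_op d w i = poly_lap (symbol l d) w i" .
qed

text \<open>At \<open>\<theta> = 0\<close> the symbol is the sum of the coefficients of \<open>d\<close>, which vanishes.\<close>
lemma symbol_eq_pCons_0:
  assumes d: "d \<in> coeff_space l"
  obtains q where "symbol l d = pCons 0 q"
proof -
  have s: "d (- j) = d j" for j using d by (auto simp: mem_coeff_space_iff)
  have "poly (symbol l d) 0 = (\<Sum>j\<in>{- int (Suc l)..int (Suc l)}. d j)"
    unfolding sum_symmetric_interval by (simp add: symbol_def poly_sum poly_shift_poly_0 s algebra_simps)
  also have "\<dots> = 0" using d by (auto simp: mem_coeff_space_iff)
  finally have "poly (symbol l d) 0 = 0" .
  then show ?thesis using that by (cases "symbol l d") auto
qed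

text \<open>Convolution with this sequence is \<open>lap\<close>.\<close>
definition lap_seq :: "int \<Rightarrow> 'a::comm_ring_1" where
  "lap_seq j = (if j = 0 then 2 else if \<bar>j\<bar> = 1 then - 1 else 0)"

lemma lap_seq_in_coeff_space: "lap_seq \<in> coeff_space l"
proof -
  have "(\<Sum>j\<in>{- int (Suc l)..int (Suc l)}. lap_seq j :: 'a) = (\<Sum>j\<in>{- 1..1}. lap_seq j)"
    by (rule sum.mono_neutral_right) (auto simp: lap_seq_def)
  also have "{- 1..1::int} = {-1, 0, 1}" by auto
  finally show ?thesis by (auto simp: mem_coeff_space_iff lap_seq_def)
qed

lemma symbol_add_lap_seq:
  "symbol l (\<lambda>j. d j + c * lap_seq j) = symbol l d + pCons 0 [:c:]"
proof -
  have "(\<Sum>j=1..Suc l. Polynomial.smult (c * lap_seq (int j)) (shift_poly j))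
    = (\<Sum>j\<in>{1}. Polynomial.smult (c * lap_seq (int j)) (shift_poly j))"
    by (rule sum.mono_neutral_right) (auto simp: lap_seq_def)
  then show ?thesis
    by (simp add: symbol_def smult_add_left sum.distrib lap_seq_def)
qed

section \<open>Resolvent bounds away from the spectrum\<close>

text \<open>Inversion of \<open>1 - z S\<close>, where \<open>S\<close> is the shift. If \<open>s\<close> is the supremum of \<open>\<bar>u\<bar> / W\<close>, the
  equation gives \<open>s \<le> \<theta> s + F\<close> with \<open>\<theta> = \<bar>z\<bar> / \<rho> < 1\<close>. The a priori bound \<open>B\<close> makes \<open>s\<close> finite, so
  that the term \<open>\<theta> s\<close> can be absorbed.\<close>
lemma first_order_bound:
  fixes u :: "int \<Rightarrow> complex" and W :: "int \<Rightarrow> real"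
  assumes bnd: "\<And>i. cmod (u i) \<le> B" and m: "m > 0" "\<And>i. m \<le> W i"
    and W: "\<And>i. \<rho> * W (i - 1) \<le> W i" and z: "cmod z < \<rho>"
    and F: "\<And>i. cmod (u i - z * u (i - 1)) \<le> F * W i"
  shows "cmod (u i) \<le> F / (1 - cmod z / \<rho>) * W i"
proof -
  define \<theta> where "\<theta> = cmod z / \<rho>"
  define S where "S = (SUP i. cmod (u i) / W i)"
  have \<rho>: "\<rho> > 0" using z by (smt (verit) norm_ge_zero)
  have \<theta>: "\<theta> < 1" "\<theta> \<ge> 0" using z \<rho> by (auto simp: \<theta>_def)
  have Wpos: "W i > 0" for i using m(1) m(2)[of i] by linarith
  have bdd: "bdd_above (range (\<lambda>i. cmod (u i) / W i))"
  proof (rule bdd_aboveI2)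
    show "cmod (u i) / W i \<le> B / m" for i
      using bnd[of i] m(1) m(2)[of i] order_trans[OF norm_ge_zero bnd[of i]] by (intro frac_le) auto
  qed
  have S: "cmod (u i) \<le> S * W i" for i
    using cSUP_upper[OF _ bdd, of i] Wpos[of i] by (simp add: S_def pos_divide_le_eq)
  have S0: "S \<ge> 0" using order_trans[OF norm_ge_zero S[of 0]] Wpos[of 0] by (simp add: zero_le_mult_iff)
  have "S \<le> \<theta> * S + F"
    unfolding S_def
  proof (rule cSUP_least)
    fix i
    have "cmod (u i) \<le> cmod z * cmod (u (i - 1)) + F * W i"
      using norm_triangle_ineq[of "u i - z * u (i - 1)" "z * u (i - 1)"] F[of i] by (simp add: norm_mult)
    also have "cmod z * cmod (u (i - 1)) \<le> cmod z * (S * W (i - 1))"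
      by (intro mult_left_mono S) auto
    also have "\<dots> = \<theta> * S * (\<rho> * W (i - 1))" using \<rho> by (simp add: \<theta>_def)
    also have "\<dots> \<le> \<theta> * S * W i"
      using W[of i] \<theta> S0 by (intro mult_left_mono) auto
    finally show "cmod (u i) / W i \<le> \<theta> * (SUP i. cmod (u i) / W i) + F"
      using Wpos[of i] by (simp add: pos_divide_le_eq S_def algebra_simps)
  qed simp
  then have "S \<le> F / (1 - \<theta>)" using \<theta> by (simp add: pos_le_divide_eq algebra_simps)
  then have "S * W i \<le> F / (1 - \<theta>) * W i" using Wpos[of i] by (intro mult_right_mono) auto
  with S[of i] show ?thesis by (simp add: \<theta>_def)
qed

text \<open>Weights that are bounded away from 0 and decay at most like \<open>\<rho>^\<bar>i\<bar>\<close> in both directions.\<close>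
definition tempered :: "real \<Rightarrow> (int \<Rightarrow> real) \<Rightarrow> bool" where
  "tempered \<rho> W \<longleftrightarrow> (\<exists>m>0. \<forall>i. m \<le> W i) \<and>
     (\<forall>i. \<rho> * W (i - 1) \<le> W i) \<and> (\<forall>i. \<rho> * W (i + 1) \<le> W i)"

text \<open>Since \<open>z (L - \<alpha>) = (1 - z / S) (1 - z S)\<close>, the first order bound applies twice, the first time
  to the reflected sequence.\<close>
lemma second_order_bound:
  assumes W: "tempered \<rho> W" and u: "bounded (range u)"
    and z: "z \<noteq> 0" "cmod z < \<rho>" and \<alpha>: "2 - \<alpha> = z + 1 / z"
    and F: "\<And>i. cmod (lap u i - \<alpha> * u i) \<le> F * W i"
  shows "cmod (u i) \<le> cmod z / (1 - cmod z / \<rho>)\<^sup>2 * F * W i"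
proof -
  obtain B where B: "\<And>i. cmod (u i) \<le> B" using u by (auto simp: bounded_iff)
  obtain m where m: "m > 0" "\<And>i. m \<le> W i" using W by (auto simp: tempered_def)
  \<comment> \<open>The intermediate sequence \<open>(1 - z S) u\<close>.\<close>
  define g where "g i = u i - z * u (i - 1)" for i
  have gB: "cmod (g (- i)) \<le> B + cmod z * B" for i
    unfolding g_def
    by (rule order_trans[OF norm_triangle_ineq4])
       (auto simp: norm_mult intro!: add_mono mult_left_mono B)
  have g: "cmod (g i) \<le> cmod z * F / (1 - cmod z / \<rho>) * W i" for i
  proof -
    have "cmod (g (- (- i))) \<le> cmod z * F / (1 - cmod z / \<rho>) * W (- (- i))"
    proof (rule first_order_bound[where u = "\<lambda>i. g (- i)" and W = "\<lambda>i. W (- i)", OF gB m(1) m(2) _ z(2)])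
      show "\<rho> * W (- (i - 1)) \<le> W (- i)" for i
        using W by (auto simp: tempered_def) (metis add.commute uminus_add_conv_diff)
      fix i
      have "g (- i) - z * g (- (i - 1)) = z * ((1 / z + z) * u (- i) - u (- i - 1) - u (- i + 1))"
        using z by (simp add: g_def algebra_simps)
      also have "\<dots> = z * (lap u (- i) - \<alpha> * u (- i))"
      proof -
        have "(1 / z + z) * u (- i) = 2 * u (- i) - \<alpha> * u (- i)"
          using \<alpha> by (metis add.commute left_diff_distrib)
        then show ?thesis by (simp add: lap_def)
      qed
      finally show "cmod (g (- i) - z * g (- (i - 1))) \<le> cmod z * F * W (- i)"
        using mult_left_mono[OF F[of "- i"], of "cmod z"] by (simp add: norm_mult mult.assoc)
    qed
    then show ?thesis by simp
  qed
  have "cmod (u i) \<le> (cmod z * F / (1 - cmod z / \<rho>)) / (1 - cmod z / \<rho>) * W i"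
  proof (rule first_order_bound[OF B m _ z(2)])
    show "\<rho> * W (i - 1) \<le> W i" for i using W by (simp add: tempered_def)
    show "cmod (u i - z * u (i - 1)) \<le> cmod z * F / (1 - cmod z / \<rho>) * W i" for i
      using g[of i] by (simp add: g_def)
  qed
  then show ?thesis by (simp add: power2_eq_square)
qed

text \<open>The two roots of \<open>z^2 - (2 - \<alpha>) z + 1\<close> have product 1. If both lie on the unit circle they are
  conjugate, so \<open>2 - \<alpha>\<close> is twice a cosine and \<open>\<alpha>\<close> lies in \<open>[0,4]\<close>.\<close>
lemma resolvent_root:
  assumes \<alpha>: "\<alpha> \<notin> complex_of_real ` {0..4}"
  obtains z where "z \<noteq> 0" "cmod z < 1" "2 - \<alpha> = z + 1 / z"
proof -
  define s where "s = csqrt ((2 - \<alpha>)\<^sup>2 - 4)"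
  have s2: "s * s = (2 - \<alpha>)\<^sup>2 - 4" by (metis s_def power2_csqrt power2_eq_square)
  define a where "a = ((2 - \<alpha>) + s) / 2"
  define b where "b = ((2 - \<alpha>) - s) / 2"
  have "4 * (a * b) = ((2 - \<alpha>) + s) * ((2 - \<alpha>) - s)" by (simp add: a_def b_def)
  also have "\<dots> = (2 - \<alpha>)\<^sup>2 - s * s" by (simp add: power2_eq_square algebra_simps)
  finally have ab: "a * b = 1" using s2 by simp
  have sum: "a + b = 2 - \<alpha>" by (simp add: a_def b_def field_simps)
  have n: "cmod a * cmod b = 1" using ab by (metis norm_mult norm_one)
  have nz: "a \<noteq> 0" "b \<noteq> 0" using ab by auto
  have inv: "b = 1 / a" "a = 1 / b" using ab nz by (auto simp: field_simps)
  have "cmod a = 1" "cmod b = 1" if "1 \<le> cmod a" "1 \<le> cmod b"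
    using n mult_left_mono[OF that(2), of "cmod a"] mult_right_mono[OF that(1), of "cmod b"] that
    by simp_all
  then consider "cmod a < 1" | "cmod b < 1" | "cmod a = 1" "cmod b = 1" by force
  then show ?thesis
  proof cases
    case 1
    have "2 - \<alpha> = a + 1 / a" using sum inv(1) by metis
    then show ?thesis using that[of a] nz 1 by metis
  next
    case 2
    have "2 - \<alpha> = b + 1 / b" using sum inv(2) by (metis add.commute)
    then show ?thesis using that[of b] nz 2 by metis
  next
    case 3
    have "b = cnj a"
      using inv(1) 3(1) by (simp add: complex_div_cnj[of 1 a])
    then have e: "2 - \<alpha> = complex_of_real (2 * Re a)" using sum by (simp add: complex_add_cnj)
    have "\<bar>Re a\<bar> \<le> 1" using abs_Re_le_cmod[of a] 3 by simp
    moreover have "\<alpha> = complex_of_real (2 - 2 * Re a)" using e by (simp add: algebra_simps)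
    ultimately have "\<alpha> \<in> complex_of_real ` {0..4}" by (intro image_eqI[where x = "2 - 2 * Re a"]) auto
    with \<alpha> show ?thesis by simp
  qed
qed

lemma norm_lap_le: "cmod (lap u i) \<le> 2 * cmod (u i) + cmod (u (i - 1)) + cmod (u (i + 1))"
  using norm_triangle_ineq4[of "2 * u i - u (i - 1)" "u (i + 1)"]
    norm_triangle_ineq4[of "2 * u i" "u (i - 1)"] by (simp add: lap_def norm_mult)

lemma bounded_poly_lap:
  assumes "bounded (range w)"
  shows "bounded (range (poly_lap p w))"
proof (induction p)
  case 0
  then show ?case by (auto simp: bounded_iff intro: exI[of _ 0])
next
  case (pCons a p)
  obtain B where B: "\<And>i. cmod (w i) \<le> B" using assms by (auto simp: bounded_iff)
  obtain C where C: "\<And>i. cmod (poly_lap p w i) \<le> C" using pCons.IH by (auto simp: bounded_iff)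
  have "cmod (poly_lap (pCons a p) w i) \<le> cmod a * B + (2 * C + C + C)" for i
  proof -
    have "cmod (poly_lap (pCons a p) w i) \<le> cmod a * cmod (w i) + cmod (lap (poly_lap p w) i)"
      unfolding poly_lap_pCons using norm_triangle_ineq by (metis norm_mult)
    also have "cmod a * cmod (w i) \<le> cmod a * B" by (intro mult_left_mono B) auto
    also have "cmod (lap (poly_lap p w) i) \<le> 2 * C + C + C"
      using norm_lap_le[of "poly_lap p w" i] C[of i] C[of "i - 1"] C[of "i + 1"] by linarith
    finally show ?thesis by simp
  qed
  then show ?case by (auto simp: bounded_iff)
qed

text \<open>One linear factor of \<open>q\<close> is removed at a time. The threshold \<open>\<rho>0\<close> is chosen before the weight because
  \<open>\<rho>\<close> must exceed the moduli \<open>\<bar>z\<bar>\<close> belonging to all roots of \<open>q\<close> simultaneously; the constant depends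
  only on \<open>q\<close> and \<open>\<rho>\<close>, hence not on \<open>N\<close> when \<open>u\<close> ranges over \<open>E_space N\<close>.\<close>
lemma poly_lap_inverse_bound:
  assumes "\<And>x. 0 \<le> x \<Longrightarrow> x \<le> 4 \<Longrightarrow> poly q (complex_of_real x) \<noteq> 0"
  shows "\<exists>\<rho>0. 0 < \<rho>0 \<and> \<rho>0 < 1 \<and> (\<forall>\<rho>. \<rho>0 < \<rho> \<longrightarrow> (\<exists>C>0. \<forall>W u F.
     tempered \<rho> W \<longrightarrow> bounded (range u) \<longrightarrow> (\<forall>i. cmod (poly_lap q u i) \<le> F * W i) \<longrightarrow>
     (\<forall>i. cmod (u i) \<le> C * F * W i)))"
  using assms
proof (induction "degree q" arbitrary: q)
  case 0
  then obtain a where q: "q = [:a:]" using degree_eq_zeroE by metis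
  then have a: "a \<noteq> 0" using 0(2)[of 0] by simp
  have e: "poly_lap q u i = a * u i" for u i by (simp add: q poly_lap_pCons lap_def)
  show ?case
  proof (rule exI[of _ "1/2"], intro conjI allI impI exI[of _ "1 / cmod a"])
    fix \<rho> :: real and W u F i assume "\<forall>i. cmod (poly_lap q u i) \<le> F * W i"
    then show "cmod (u i) \<le> 1 / cmod a * F * W i"
      using a by (simp add: e norm_mult field_simps)
  qed (use a in auto)
next
  case (Suc n)
  have "\<not> constant (poly q)" using Suc(2) by (simp add: constant_degree)
  then obtain \<alpha> where "poly q \<alpha> = 0" using fundamental_theorem_of_algebra by blast
  then obtain q' where q: "q = [:- \<alpha>, 1:] * q'" by (metis poly_eq_0_iff_dvd dvdE)
  have "q' \<noteq> 0" using Suc(2) q by auto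
  then have "degree q = Suc (degree q')" unfolding q by (subst degree_mult_eq) auto
  then have "n = degree q'" using Suc(2) by simp
  moreover have "poly q' (complex_of_real x) \<noteq> 0" if "0 \<le> x" "x \<le> 4" for x
    using Suc(3)[OF that] q by simp
  ultimately obtain \<rho>1 where \<rho>1: "0 < \<rho>1" "\<rho>1 < 1" and est: "\<And>\<rho>. \<rho>1 < \<rho> \<Longrightarrow> (\<exists>C>0. \<forall>W u F.
     tempered \<rho> W \<longrightarrow> bounded (range u) \<longrightarrow> (\<forall>i. cmod (poly_lap q' u i) \<le> F * W i) \<longrightarrow>
     (\<forall>i. cmod (u i) \<le> C * F * W i))"
    using Suc(1)[of q'] by blast
  have "\<alpha> \<notin> complex_of_real ` {0..4}" using Suc(3) \<open>poly q \<alpha> = 0\<close> by auto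
  then obtain z where z: "z \<noteq> 0" "cmod z < 1" "2 - \<alpha> = z + 1 / z" by (rule resolvent_root)
  show ?case
  proof (rule exI[of _ "max \<rho>1 (cmod z)"], intro conjI allI impI)
    fix \<rho> assume "max \<rho>1 (cmod z) < \<rho>"
    then have \<rho>: "\<rho>1 < \<rho>" "cmod z < \<rho>" by auto
    obtain C where C: "C > 0" "\<And>W u F i. tempered \<rho> W \<Longrightarrow> bounded (range u) \<Longrightarrow>
        (\<forall>i. cmod (poly_lap q' u i) \<le> F * W i) \<Longrightarrow> cmod (u i) \<le> C * F * W i"
      using est[OF \<rho>(1)] by blast
    define K where "K = cmod z / (1 - cmod z / \<rho>)\<^sup>2"
    have "cmod z / \<rho> < 1" using \<rho> by (smt (verit) divide_less_eq_1_pos norm_ge_zero)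
    then have K: "K > 0" using z by (auto simp: K_def intro!: divide_pos_pos zero_less_power)
    show "\<exists>C>0. \<forall>W u F.
     tempered \<rho> W \<longrightarrow> bounded (range u) \<longrightarrow> (\<forall>i. cmod (poly_lap q u i) \<le> F * W i) \<longrightarrow>
     (\<forall>i. cmod (u i) \<le> C * F * W i)"
    proof (rule exI[of _ "C * K"], intro conjI allI impI)
      show "C * K > 0" using C K by simp
      fix W u F i
      assume W: "tempered \<rho> W" and u: "bounded (range u)"
        and F: "\<forall>i. cmod (poly_lap q u i) \<le> F * W i"
      have "cmod (poly_lap q' u i) \<le> K * F * W i" for i
        unfolding K_def
      proof (rule second_order_bound[OF W bounded_poly_lap[OF u] z(1) \<rho>(2) z(3)])
        show "cmod (lap (poly_lap q' u) i - \<alpha> * poly_lap q' u i) \<le> F * W i" for i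
          using F[rule_format, of i] unfolding q poly_lap_mult poly_lap_linear by simp
      qed
      then have "cmod (u i) \<le> C * (K * F) * W i" using C(2)[OF W u, of "K * F"] by blast
      then show "cmod (u i) \<le> C * K * F * W i" by (simp add: mult.assoc)
    qed
  qed (use \<rho>1 z in auto)
qed

section \<open>Grid functions and the comparison principle\<close>

lemma periodic_mod:
  fixes f :: "int \<Rightarrow> 'a"
  assumes "\<And>i. f (i + p) = f i"
  shows "f (i mod p) = f i"
proof -
  interpret periodic_fun_simple f p by standard (rule assms)
  show ?thesis using plus_of_int[of i "- (i div p)"] by (simp add: minus_div_mult_eq_mod[symmetric])
qed

lemma E_space_zero: "w \<in> E_space N \<Longrightarrow> w 0 = 0" "w \<in> E_space N \<Longrightarrow> w (int N + 1) = 0"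
proof -
  assume "w \<in> E_space N"
  then have a: "\<And>j. w (- j) = - w j \<and> w (int N + 1 + j) = - w (int N + 1 - j)"
    by (auto simp: E_space_def)
  show "w 0 = 0" "w (int N + 1) = 0" using a[of 0] by simp_all
qed

text \<open>By oddness and periodicity a sequence in \<open>E_space N\<close> is controlled by its values at \<open>1..N\<close>, and the
  points 0 and \<open>N + 1\<close> carry zeros. This carries estimates on the grid to the whole line, where the
  shift can be inverted.\<close>
lemma E_space_bound:
  assumes w: "w \<in> E_space N" and even: "\<And>i. B (- i) = B i"
    and per: "\<And>i. B (i + (2 * int N + 2)) = B i" and nonneg: "\<And>i. 0 \<le> (B i :: real)"
    and le: "\<And>j. j \<in> {1..int N} \<Longrightarrow> cmod (w j) \<le> B j"
  shows "cmod (w i) \<le> B i"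
proof -
  let ?p = "2 * int N + 2"
  have a: "w (- j) = - w j" "w (int N + 1 + j) = - w (int N + 1 - j)" for j
    using w by (auto simp: E_space_def)
  have perw: "w (j + ?p) = w j" for j
  proof -
    have "w (j + ?p) = w (int N + 1 + (int N + 1 + j))" by (simp add: algebra_simps)
    also have "\<dots> = - w (- j)" by (subst a(2)) simp
    finally show ?thesis by (simp add: a(1))
  qed
  define s where "s = i mod ?p"
  have s: "0 \<le> s" "s < ?p" by (auto simp: s_def)
  have half: "cmod (w j) \<le> B j" if "0 \<le> j" "j \<le> int N + 1" for j
  proof -
    consider "j = 0" | "j = int N + 1" | "j \<in> {1..int N}" using \<open>0 \<le> j\<close> \<open>j \<le> int N + 1\<close> by fastforce
    then show ?thesis by cases (use E_space_zero[OF w] nonneg le in auto)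
  qed
  have "cmod (w s) \<le> B s"
  proof (cases "s \<le> int N + 1")
    case True
    then show ?thesis using half s by blast
  next
    case False
    have "cmod (w (?p - s)) \<le> B (?p - s)" using False s by (intro half) auto
    moreover have "w (- s + ?p) = - w s" "B (- s + ?p) = B s"
      using perw[of "- s"] per[of "- s"] a(1)[of s] even[of s] by auto
    ultimately show ?thesis by (simp add: algebra_simps)
  qed
  moreover have "w s = w i" "B s = B i"
    unfolding s_def by (rule periodic_mod; rule perw per)+
  ultimately show ?thesis by simp
qed

lemma E_space_bounded: "w \<in> E_space N \<Longrightarrow> bounded (range w)"
proof -
  assume w: "w \<in> E_space N"
  define B where "B = (\<Sum>j\<in>{1..int N}. cmod (w j))"
  have "cmod (w i) \<le> B" for i
    by (rule E_space_bound[OF w, where B = "\<lambda>_. B"])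
       (auto simp: B_def sum_nonneg intro!: member_le_sum)
  then show ?thesis by (auto simp: bounded_iff)
qed

text \<open>At the leftmost point where the maximum is attained, the left neighbour is strictly smaller, which
  contradicts convexity there unless that point is on the boundary.\<close>
lemma discrete_maximum_principle:
  fixes g :: "int \<Rightarrow> real"
  assumes M: "0 \<le> M" and bd: "g 0 \<le> 0" "g M \<le> 0"
    and sub: "\<And>j. 0 < j \<Longrightarrow> j < M \<Longrightarrow> 2 * g j \<le> g (j - 1) + g (j + 1)"
    and j: "0 \<le> j" "j \<le> M"
  shows "g j \<le> 0"
proof -
  define m where "m = Max (g ` {0..M})"
  have le: "g i \<le> m" if "i \<in> {0..M}" for i using that by (auto simp: m_def)
  have "m \<in> g ` {0..M}" unfolding m_def using M by (intro Max_in) auto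
  then have ne: "{i \<in> {0..M}. g i = m} \<noteq> {}" by auto
  define k where "k = Min {i \<in> {0..M}. g i = m}"
  have fin: "finite {i \<in> {0..M}. g i = m}" by (rule finite_subset[of _ "{0..M}"]) auto
  have kmin: "k \<le> i" if "i \<in> {i \<in> {0..M}. g i = m}" for i
    unfolding k_def using fin that by (rule Min_le)
  have k: "k \<in> {0..M}" "g k = m" using Min_in[OF fin ne] by (auto simp: k_def)
  have "m \<le> 0"
  proof (rule ccontr)
    assume "\<not> m \<le> 0"
    then have "k \<noteq> 0" "k \<noteq> M" using bd k by auto
    then have k': "0 < k" "k < M" using k by auto
    have "k - 1 \<notin> {i \<in> {0..M}. g i = m}"
      using kmin[of "k - 1"] by linarith
    then have "g (k - 1) < m" using le[of "k - 1"] k' by fastforce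
    moreover have "g (k + 1) \<le> m" using le[of "k + 1"] k' by auto
    ultimately show False using sub[OF k'] k by simp
  qed
  then show ?thesis using le[of j] j by auto
qed

text \<open>The modulus of a complex sequence satisfies \<open>L \<bar>v\<bar> \<le> \<bar>L v\<bar>\<close> by the triangle inequality, so the
  real maximum principle applies to \<open>\<bar>v\<bar> - \<psi>\<close>.\<close>
lemma lap_comparison:
  fixes \<psi> :: "int \<Rightarrow> real"
  assumes v: "v \<in> E_space N" and bd: "0 \<le> \<psi> 0" "0 \<le> \<psi> (int N + 1)"
    and le: "\<And>j. 0 < j \<Longrightarrow> j < int N + 1 \<Longrightarrow> cmod (lap v j) \<le> 2 * \<psi> j - \<psi> (j - 1) - \<psi> (j + 1)"
    and j: "0 \<le> j" "j \<le> int N + 1"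
  shows "cmod (v j) \<le> \<psi> j"
proof -
  have "cmod (v j) - \<psi> j \<le> 0"
  proof (rule discrete_maximum_principle[OF _ _ _ _ j])
    fix j assume j: "0 < j" "j < int N + 1"
    have "2 * cmod (v j) = cmod (lap v j + v (j - 1) + v (j + 1))"
      by (simp add: lap_def norm_mult)
    also have "\<dots> \<le> cmod (lap v j) + cmod (v (j - 1)) + cmod (v (j + 1))"
      by (intro order_trans[OF norm_triangle_ineq] add_mono norm_triangle_ineq) simp
    finally show "2 * (cmod (v j) - \<psi> j)
        \<le> cmod (v (j - 1)) - \<psi> (j - 1) + (cmod (v (j + 1)) - \<psi> (j + 1))"
      using le[OF j] by simp
  qed (use bd E_space_zero[OF v] in auto)
  then show ?thesis by simp
qed

text \<open>The comparison function is the parabola \<open>F j (N + 1 - j) / 2\<close>, for which \<open>L\<close> takes the value \<open>F\<close>.\<close>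
lemma lap_inverse_bound:
  assumes v: "v \<in> E_space N" and F: "\<And>j. j \<in> {1..int N} \<Longrightarrow> cmod (lap v j) \<le> F"
    and N: "N \<ge> 1" and j: "j \<in> {1..int N}"
  shows "cmod (v j) \<le> (real N + 1)\<^sup>2 * F"
proof -
  have F0: "F \<ge> 0" using order_trans[OF norm_ge_zero F[of 1]] N by auto
  have "cmod (v j) \<le> F * (real_of_int j * (real N + 1 - real_of_int j) / 2)"
  proof (rule lap_comparison[OF v, where \<psi> = "\<lambda>j. F * (real_of_int j * (real N + 1 - real_of_int j) / 2)"])
    fix j assume "0 < j" "j < int N + 1"
    then show "cmod (lap v j) \<le> 2 * (F * (real_of_int j * (real N + 1 - real_of_int j) / 2)) -
         F * (real_of_int (j - 1) * (real N + 1 - real_of_int (j - 1)) / 2) -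
         F * (real_of_int (j + 1) * (real N + 1 - real_of_int (j + 1)) / 2)"
      using F[of j] by (simp add: field_simps)
  qed (use j in auto)
  also have "\<dots> \<le> F * (real N + 1)\<^sup>2"
  proof (intro mult_left_mono F0)
    have "real_of_int j * (real N + 1 - real_of_int j) \<le> (real N + 1) * (real N + 1)"
      using j by (intro mult_mono) auto
    moreover have "0 \<le> (real N + 1) * (real N + 1)" by simp
    ultimately show "real_of_int j * (real N + 1 - real_of_int j) / 2 \<le> (real N + 1)\<^sup>2"
      unfolding power2_eq_square by linarith
  qed
  finally show ?thesis by (simp add: mult.commute)
qed

text \<open>Both notions of stability ask for the maximum norm of \<open>w\<close> to be bounded by a weighted maximum norm
  of the image. The maxima are replaced by quantifiers over the grid so that the condition on \<open>d\<close> is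
  visibly closed.\<close>
definition lower_bound :: "real \<Rightarrow> (nat \<Rightarrow> real) \<Rightarrow> nat \<Rightarrow> (int \<Rightarrow> complex) \<Rightarrow> bool" where
  "lower_bound c \<omega> N d \<longleftrightarrow> (\<forall>w\<in>E_space N. \<forall>i\<in>{1..N}. \<exists>j\<in>{1..N}.
     c * cmod (w (int i)) \<le> \<omega> j * cmod (T_op d w (int j)))"

lemma lower_boundI:
  assumes c: "c > 0" and N: "N \<ge> 1" and \<omega>: "\<And>j. \<omega> j \<ge> 0"
    and le: "\<And>w M i. w \<in> E_space N \<Longrightarrow> 0 \<le> M \<Longrightarrow>
      (\<And>j. j \<in> {1..N} \<Longrightarrow> \<omega> j * cmod (T_op d w (int j)) \<le> M) \<Longrightarrow> i \<in> {1..N} \<Longrightarrow>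
      c * cmod (w (int i)) \<le> M"
  shows "lower_bound c \<omega> N d"
  unfolding lower_bound_def
proof (intro ballI)
  fix w i assume w: "w \<in> E_space N" and i: "i \<in> {1..N}"
  let ?S = "(\<lambda>j. \<omega> j * cmod (T_op d w (int j))) ` {1..N}"
  have "Max ?S \<in> ?S" using N by (intro Max_in) auto
  then obtain j where j: "j \<in> {1..N}" "Max ?S = \<omega> j * cmod (T_op d w (int j))" by auto
  have "c * cmod (w (int i)) \<le> \<omega> j * cmod (T_op d w (int j))"
  proof (rule le[OF w _ _ i])
    show "0 \<le> \<omega> j * cmod (T_op d w (int j))" using \<omega> by simp
    show "\<omega> k * cmod (T_op d w (int k)) \<le> \<omega> j * cmod (T_op d w (int j))" if "k \<in> {1..N}" for k
      unfolding j(2)[symmetric] using that by (intro Max_ge) auto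
  qed
  with j(1) show "\<exists>j\<in>{1..N}. c * cmod (w (int i)) \<le> \<omega> j * cmod (T_op d w (int j))" by blast
qed

section \<open>Strong stability\<close>

text \<open>The distance to the lattice generated by \<open>N + 1\<close>, that is, to the periodic images of the two
  boundary points.\<close>
definition bdry_dist :: "nat \<Rightarrow> int \<Rightarrow> int" where
  "bdry_dist N i = min (i mod (int N + 1)) (int N + 1 - i mod (int N + 1))"

lemma bdry_dist_periodic: "bdry_dist N (i + (2 * int N + 2)) = bdry_dist N i"
proof -
  have "(i + (2 * int N + 2)) mod (int N + 1) = (i + 2 * (int N + 1)) mod (int N + 1)"
    by (simp add: algebra_simps)
  also have "\<dots> = i mod (int N + 1)" by (rule mod_mult_self1)
  finally show ?thesis by (simp add: bdry_dist_def)
qed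

lemma bdry_dist_uminus: "bdry_dist N (- i) = bdry_dist N i"
proof -
  define r where "r = i mod (int N + 1)"
  have "r < int N + 1" unfolding r_def by (rule pos_mod_bound) simp
  moreover have "(- i) mod (int N + 1) = (if r = 0 then 0 else int N + 1 - r)"
    by (simp add: r_def zmod_zminus1_eq_if)
  ultimately show ?thesis unfolding bdry_dist_def r_def[symmetric] by auto
qed

lemma bdry_dist_inside: "j \<in> {1..int N} \<Longrightarrow> bdry_dist N j = min j (int N + 1 - j)"
  by (auto simp: bdry_dist_def)

lemma bdry_dist_step: "\<bar>bdry_dist N (i + 1) - bdry_dist N i\<bar> \<le> 1"
proof -
  define r where "r = i mod (int N + 1)"
  have r: "0 \<le> r" "r < int N + 1" unfolding r_def by (rule pos_mod_sign pos_mod_bound; simp)+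
  have e: "(i + 1) mod (int N + 1) = (r + 1) mod (int N + 1)" by (simp add: r_def mod_add_left_eq)
  show ?thesis
  proof (cases "r + 1 < int N + 1")
    case True
    then have "(i + 1) mod (int N + 1) = r + 1" using r e by simp
    then show ?thesis by (auto simp: bdry_dist_def r_def[symmetric])
  next
    case False
    then have "r + 1 = int N + 1" using r by simp
    then have "(i + 1) mod (int N + 1) = 0" "r = int N" using e by auto
    then show ?thesis by (auto simp: bdry_dist_def r_def[symmetric])
  qed
qed

definition bdry_weight :: "real \<Rightarrow> nat \<Rightarrow> int \<Rightarrow> real" where
  "bdry_weight \<rho> N i = (mesh N)\<^sup>2 + \<rho> powi bdry_dist N i"

lemma mesh_pos: "mesh N > 0" by (simp add: mesh_def)

lemma tempered_bdry_weight:
  assumes \<rho>: "0 < \<rho>" "\<rho> < 1"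
  shows "tempered \<rho> (bdry_weight \<rho> N)"
proof -
  have step: "\<rho> * bdry_weight \<rho> N i \<le> bdry_weight \<rho> N j" if "\<bar>bdry_dist N j - bdry_dist N i\<bar> \<le> 1" for i j
  proof -
    have "\<rho> * \<rho> powi bdry_dist N i = \<rho> powi (1 + bdry_dist N i)"
      using \<rho> by (simp add: power_int_add)
    also have "\<dots> \<le> \<rho> powi bdry_dist N j"
      using that \<rho> by (intro power_int_decreasing) auto
    finally have "\<rho> * \<rho> powi bdry_dist N i \<le> \<rho> powi bdry_dist N j" .
    moreover have "\<rho> * (mesh N)\<^sup>2 \<le> (mesh N)\<^sup>2"
      using \<rho> by (intro mult_left_le_one_le) auto
    ultimately show ?thesis by (simp add: bdry_weight_def algebra_simps)
  qed
  have "(mesh N)\<^sup>2 > 0" using mesh_pos[of N] by simp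
  moreover have "(mesh N)\<^sup>2 \<le> bdry_weight \<rho> N i" for i
    using \<rho> by (simp add: bdry_weight_def)
  moreover have "\<rho> * bdry_weight \<rho> N (i - 1) \<le> bdry_weight \<rho> N i" for i
    using bdry_dist_step[of N "i - 1"] by (intro step) simp
  moreover have "\<rho> * bdry_weight \<rho> N (i + 1) \<le> bdry_weight \<rho> N i" for i
    using bdry_dist_step[of N i] by (intro step) linarith
  ultimately show ?thesis unfolding tempered_def by blast
qed

text \<open>The factor of \<open>F\<close> does not depend on \<open>N\<close>. On the geometric sequence \<open>e i = \<rho>^i\<close> the operator \<open>L\<close>
  is multiplication by \<open>-(1 - \<rho>)^2 / \<rho>\<close>, so with \<open>K = \<rho> / (1 - \<rho>)^2\<close> the bounded functions
  \<open>K (1 - \<rho>^i)\<close> and their mirror images absorb the two boundary layers. The parabola absorbs \<open>h^2\<close>.\<close>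
lemma lap_inverse_bdry_weight:
  assumes \<rho>: "0 < \<rho>" "\<rho> < 1" and v: "v \<in> E_space N" and F0: "F \<ge> 0"
    and F: "\<And>j. j \<in> {1..int N} \<Longrightarrow> cmod (lap v j) \<le> F * bdry_weight \<rho> N j"
    and j: "j \<in> {1..int N}"
  shows "cmod (v j) \<le> F * (1 / 2 + 2 * (\<rho> / (1 - \<rho>)\<^sup>2))"
proof -
  define K where "K = \<rho> / (1 - \<rho>)\<^sup>2"
  define h where "h = mesh N"
  define M where "M = real N + 1"
  have h: "h * M = 1" by (simp add: h_def M_def mesh_def)
  have K0: "K > 0" using \<rho> by (simp add: K_def)
  define e where "e i = \<rho> powi i" for i :: int
  have e_pos: "e i > 0" for i using \<rho> by (simp add: e_def)
  have e_lap: "K * (e (i - 1) + e (i + 1) - 2 * e i) = e i" for i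
  proof -
    have "e (i - 1) = e i / \<rho>" "e (i + 1) = e i * \<rho>"
      using \<rho> by (simp_all add: e_def power_int_diff power_int_add)
    then have "e (i - 1) + e (i + 1) - 2 * e i = e i * (1 - \<rho>)\<^sup>2 / \<rho>"
      using \<rho> by (simp add: field_simps power2_eq_square)
    then show ?thesis using \<rho> by (simp add: K_def)
  qed
  define \<psi> where "\<psi> i = F * (h\<^sup>2 * (real_of_int i * (M - real_of_int i)) / 2
      + K * (1 - e i) + K * (1 - e (int N + 1 - i)))" for i
  have "cmod (v j) \<le> \<psi> j"
  proof (rule lap_comparison[OF v])
    have "e (int N + 1) \<le> 1" using power_int_decreasing[of 0 "int N + 1" \<rho>] \<rho> by (simp add: e_def)
    then show "0 \<le> \<psi> 0" "0 \<le> \<psi> (int N + 1)" using F0 K0 by (auto simp: \<psi>_def e_def M_def)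
  next
    fix i assume i: "0 < i" "i < int N + 1"
    have "bdry_weight \<rho> N i \<le> h\<^sup>2 + (e i + e (int N + 1 - i))"
      using bdry_dist_inside[of i N] i e_pos[of i] e_pos[of "int N + 1 - i"]
      by (auto simp: bdry_weight_def h_def min_def e_def)
    then have "F * bdry_weight \<rho> N i \<le> F * (h\<^sup>2 + (e i + e (int N + 1 - i)))"
      using F0 by (intro mult_left_mono)
    moreover have "2 * \<psi> i - \<psi> (i - 1) - \<psi> (i + 1) = F * (h\<^sup>2
       + K * (e (i - 1) + e (i + 1) - 2 * e i)
       + K * (e (int N + 1 - i - 1) + e (int N + 1 - i + 1) - 2 * e (int N + 1 - i)))"
    proof -
      have r: "int N + 1 - (i - 1) = int N + 1 - i + 1" "int N + 1 - (i + 1) = int N + 1 - i - 1" by auto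
      show ?thesis unfolding \<psi>_def r of_int_add of_int_diff of_int_1
        by (simp add: field_simps power2_eq_square)
    qed
    ultimately show "cmod (lap v i) \<le> 2 * \<psi> i - \<psi> (i - 1) - \<psi> (i + 1)"
      using F[of i] i unfolding e_lap by (simp add: add.assoc)
  qed (use j in auto)
  also have "\<psi> j \<le> F * (1 / 2 + 2 * K)"
    unfolding \<psi>_def
  proof (intro mult_left_mono F0)
    have "h\<^sup>2 * (real_of_int j * (M - real_of_int j)) \<le> h\<^sup>2 * (M * M)"
      using j by (intro mult_left_mono mult_mono) (auto simp: M_def)
    also have "\<dots> = 1" using h by (metis mult.assoc mult.left_commute mult_1 power2_eq_square)
    finally have "h\<^sup>2 * (real_of_int j * (M - real_of_int j)) \<le> 1" .
    moreover have "K * (1 - e i) \<le> K * 1" for i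
      using e_pos[of i] K0 by (intro mult_left_mono) auto
    from this[of j] this[of "int N + 1 - j"] have "K * (1 - e j) + K * (1 - e (int N + 1 - j)) \<le> 2 * K"
      by simp
    ultimately show "h\<^sup>2 * (real_of_int j * (M - real_of_int j)) / 2
      + K * (1 - e j) + K * (1 - e (int N + 1 - j)) \<le> 1 / 2 + 2 * K" by simp
  qed
  finally show ?thesis by (simp add: K_def)
qed

text \<open>Near the boundary, at distance at most \<open>r\<close>, the datum is only bounded by \<open>M\<close>; there the weight
  is at least \<open>\<rho>^r\<close>, which explains the factor \<open>R = \<rho>^(-r)\<close>. In the interior the datum is bounded by \<open>M h^2\<close>.\<close>
lemma lower_bound_strong:
  assumes d: "d \<in> coeff_space l" and q: "symbol l d = pCons 0 q"
    and nz: "\<And>x. 0 \<le> x \<Longrightarrow> x \<le> 4 \<Longrightarrow> poly q (complex_of_real x) \<noteq> 0"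
  shows "\<exists>c>0. \<forall>N\<ge>1. lower_bound c (weight r N) N d"
proof -
  obtain \<rho>0 where \<rho>0: "0 < \<rho>0" "\<rho>0 < 1" and est: "\<And>\<rho>. \<rho>0 < \<rho> \<Longrightarrow> (\<exists>C>0. \<forall>W u F.
     tempered \<rho> W \<longrightarrow> bounded (range u) \<longrightarrow> (\<forall>i. cmod (poly_lap q u i) \<le> F * W i) \<longrightarrow>
     (\<forall>i. cmod (u i) \<le> C * F * W i))"
    using poly_lap_inverse_bound[OF nz] by blast
  \<comment> \<open>The rate must exceed the threshold for \<open>q\<close> and stay below 1, so that the layers remain bounded.\<close>
  define \<rho> where "\<rho> = (\<rho>0 + 1) / 2"
  have \<rho>: "\<rho>0 < \<rho>" "0 < \<rho>" "\<rho> < 1" using \<rho>0 by (auto simp: \<rho>_def)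
  obtain C where C: "C > 0" "\<And>W u F i. tempered \<rho> W \<Longrightarrow> bounded (range u) \<Longrightarrow>
      (\<forall>i. cmod (poly_lap q u i) \<le> F * W i) \<Longrightarrow> cmod (u i) \<le> C * F * W i"
    using est[OF \<rho>(1)] by blast
  define R where "R = \<rho> powi (- int r)"
  have R: "R > 0" "R \<ge> 1"
    using \<rho> power_int_decreasing[of "- int r" 0 \<rho>] by (simp_all add: R_def)
  define K where "K = 1 / 2 + 2 * (\<rho> / (1 - \<rho>)\<^sup>2)"
  have K: "K > 0" using \<rho> by (auto simp: K_def intro!: add_pos_pos divide_pos_pos)
  show ?thesis
  proof (intro exI[of _ "1 / (C * R * K)"] conjI allI impI)
    show pos: "1 / (C * R * K) > 0" using C R K by simp
    fix N :: nat assume N: "N \<ge> 1"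
    show "lower_bound (1 / (C * R * K)) (weight r N) N d"
    proof (rule lower_boundI[OF pos N])
      show "weight r N j \<ge> 0" for j by (simp add: weight_def)
      fix w M i
      assume w: "w \<in> E_space N" and M: "0 \<le> M" and i: "i \<in> {1..N}"
        and le: "\<And>j. j \<in> {1..N} \<Longrightarrow> weight r N j * cmod (T_op d w (int j)) \<le> M"
      define f where "f = T_op d w"
      have f: "f = poly_lap q (lap w)"
        unfolding f_def T_op_eq_poly_lap[OF d] q by (rule ext) (simp add: poly_lap_pCons lap_poly_lap)
      have fE: "f \<in> E_space N" unfolding f by (intro poly_lap_E_space lap_E_space w)
      have Wpos: "bdry_weight \<rho> N i \<ge> 0" for i using \<rho> by (simp add: bdry_weight_def)
      have fb: "cmod (f j) \<le> R * M * bdry_weight \<rho> N j" for j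
      proof (rule E_space_bound[OF fE])
        show "R * M * bdry_weight \<rho> N (- i) = R * M * bdry_weight \<rho> N i" for i
          by (simp add: bdry_weight_def bdry_dist_uminus)
        show "R * M * bdry_weight \<rho> N (i + (2 * int N + 2)) = R * M * bdry_weight \<rho> N i" for i
          by (simp only: bdry_weight_def bdry_dist_periodic)
        show "0 \<le> R * M * bdry_weight \<rho> N i" for i using Wpos R M by simp
        fix j assume j: "j \<in> {1..int N}"
        then have nj: "nat j \<in> {1..N}" "int (nat j) = j" by auto
        have lej: "weight r N (nat j) * cmod (f j) \<le> M" using le[OF nj(1)] nj(2) by (simp add: f_def)
        show "cmod (f j) \<le> R * M * bdry_weight \<rho> N j"
        proof (cases "r < nat j \<and> nat j + r < N + 1")
          case True
          then have "weight r N (nat j) = 1 / (mesh N)\<^sup>2" by (simp add: weight_def)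
          then have "cmod (f j) \<le> M * (mesh N)\<^sup>2"
            using lej mesh_pos[of N] by (simp add: pos_divide_le_eq)
          also have "\<dots> \<le> M * bdry_weight \<rho> N j"
            using M \<rho> by (intro mult_left_mono) (auto simp: bdry_weight_def)
          also have "\<dots> \<le> R * (M * bdry_weight \<rho> N j)"
            using R M Wpos[of j] mult_right_mono[of 1 R "M * bdry_weight \<rho> N j"] by simp
          finally show ?thesis by (simp add: mult.assoc)
        next
          case False
          then have "weight r N (nat j) = 1" unfolding weight_def by (rule if_not_P)
          then have "cmod (f j) \<le> M" using lej by simp
          moreover have "bdry_dist N j \<le> int r" using False j by (auto simp: bdry_dist_inside)
          then have "1 \<le> \<rho> powi (- int r + bdry_dist N j)"
            using \<rho> power_int_decreasing[of "- int r + bdry_dist N j" 0 \<rho>] by simp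
          then have "1 \<le> R * \<rho> powi bdry_dist N j"
            unfolding R_def by (subst power_int_add[symmetric]) (use \<rho> in auto)
          then have "1 \<le> R * bdry_weight \<rho> N j"
            using R by (simp add: bdry_weight_def distrib_left add_increasing)
          then have "M * 1 \<le> M * (R * bdry_weight \<rho> N j)" using M by (intro mult_left_mono)
          ultimately show ?thesis by (simp add: ac_simps)
        qed
      qed
      have "cmod (lap w j) \<le> C * (R * M) * bdry_weight \<rho> N j" for j
        using C(2)[OF tempered_bdry_weight[OF \<rho>(2,3)] E_space_bounded[OF lap_E_space[OF w]], of "R * M" N] fb
        unfolding f by blast
      then have "cmod (w (int i)) \<le> C * (R * M) * K"
        unfolding K_def using i C R M by (intro lap_inverse_bdry_weight[OF \<rho>(2,3) w]) auto
      then show "1 / (C * R * K) * cmod (w (int i)) \<le> M"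
        using C R K by (simp add: field_simps)
    qed
  qed
qed

section \<open>Stability when the symbol has simple roots\<close>

text \<open>Duhamel's formula for the oscillator \<open>x (n + 2) - 2 cos \<theta> x (n + 1) + x n = - g (n + 1)\<close>.\<close>
lemma recurrence_solution:
  fixes x g :: "nat \<Rightarrow> complex" and \<theta> :: real
  assumes x0: "x 0 = 0" and rec: "\<And>n. x (n + 2) = 2 * cos \<theta> * x (n + 1) - x n - g (n + 1)"
  shows "sin \<theta> * x n = x 1 * sin (real n * \<theta>) - (\<Sum>m\<in>{1..<n}. g m * sin ((real n - real m) * \<theta>))"
proof -
  define s where "s r = complex_of_real (sin (r * \<theta>))" for r :: real
  have s: "s (r + 2) = 2 * cos \<theta> * s (r + 1) - s r" for r
  proof -
    have "sin ((r + 2) * \<theta>) + sin (r * \<theta>) = 2 * sin ((r + 1) * \<theta>) * cos \<theta>"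
      using sin_plus_sin[of "(r + 2) * \<theta>" "r * \<theta>"] by (simp add: algebra_simps add_divide_distrib)
    then have "sin ((r + 2) * \<theta>) = 2 * cos \<theta> * sin ((r + 1) * \<theta>) - sin (r * \<theta>)" by (simp add: algebra_simps)
    then show ?thesis unfolding s_def by (metis (no_types) of_real_diff of_real_mult of_real_numeral)
  qed
  have s0: "s 0 = 0" "s 1 = sin \<theta>" "s (- 1) = - sin \<theta>" by (simp_all add: s_def)
  have "sin \<theta> * x n = x 1 * s (real n) - (\<Sum>m\<in>{1..<n}. g m * s (real n - real m))"
  proof (induction n rule: induct_nat_012)
    case 0
    then show ?case by (simp add: x0 s0)
  next
    case 1
    then show ?case by (simp add: s0)
  next
    case (ge2 n)
    have "(\<Sum>m\<in>{1..<Suc (Suc n)}. g m * s (real (Suc (Suc n)) - real m))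
      = (\<Sum>m\<in>{1..<Suc (Suc n)}. 2 * cos \<theta> * (g m * s (real (Suc n) - real m)) - g m * s (real n - real m))"
    proof (rule sum.cong[OF refl])
      fix m
      show "g m * s (real (Suc (Suc n)) - real m)
        = 2 * cos \<theta> * (g m * s (real (Suc n) - real m)) - g m * s (real n - real m)"
      proof -
        have e: "real (Suc (Suc n)) - real m = real n - real m + 2"
          "real (Suc n) - real m = real n - real m + 1" by simp_all
        show ?thesis unfolding e s by (simp add: algebra_simps)
      qed
    qed
    also have "\<dots> = 2 * cos \<theta> * (\<Sum>m\<in>{1..<Suc (Suc n)}. g m * s (real (Suc n) - real m))
       - (\<Sum>m\<in>{1..<Suc (Suc n)}. g m * s (real n - real m))"
      by (simp only: sum_subtractf sum_distrib_left)
    also have "(\<Sum>m\<in>{1..<Suc (Suc n)}. g m * s (real (Suc n) - real m))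
      = (\<Sum>m\<in>{1..<Suc n}. g m * s (real (Suc n) - real m))" by (simp add: s0)
    also have "(\<Sum>m\<in>{1..<Suc (Suc n)}. g m * s (real n - real m))
      = (\<Sum>m\<in>{1..<n}. g m * s (real n - real m)) - g (n + 1) * sin \<theta>"
      using s0 by (cases n) simp_all
    finally have S: "(\<Sum>m\<in>{1..<Suc (Suc n)}. g m * s (real (Suc (Suc n)) - real m))
      = 2 * cos \<theta> * (\<Sum>m\<in>{1..<Suc n}. g m * s (real (Suc n) - real m))
        - ((\<Sum>m\<in>{1..<n}. g m * s (real n - real m)) - g (n + 1) * sin \<theta>)" .
    have s': "s (real (Suc (Suc n))) = 2 * cos \<theta> * s (real (Suc n)) - s (real n)"
      using s[of "real n"] by (simp add: add.commute)
    have x': "x (Suc (Suc n)) = 2 * cos \<theta> * x (Suc n) - x n - g (n + 1)"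
      using rec[of n] by simp
    have "sin \<theta> * x (Suc (Suc n)) = 2 * cos \<theta> * (sin \<theta> * x (Suc n)) - sin \<theta> * x n - sin \<theta> * g (n + 1)"
      unfolding x' by (simp add: algebra_simps)
    then show ?case unfolding S s' ge2 by (simp add: algebra_simps)
  qed
  then show ?thesis by (simp add: s_def)
qed

text \<open>Duhamel's formula at the right boundary point, where \<open>v\<close> vanishes, determines \<open>v 1\<close> after division by
  \<open>sin ((N + 1) \<theta>)\<close>; the formula at \<open>j\<close> then bounds \<open>v j\<close>.\<close>
lemma oscillating_inverse_bound:
  assumes v: "v \<in> E_space N" and \<theta>: "0 < \<theta>" "\<theta> < pi" and s: "sin ((real N + 1) * \<theta>) \<noteq> 0"
    and F: "\<And>j. j \<in> {1..int N} \<Longrightarrow> cmod (lap v j - complex_of_real (2 - 2 * cos \<theta>) * v j) \<le> F"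
    and j: "j \<in> {1..int N}"
  shows "cmod (v j) \<le> 2 * (real N + 1) * F / (sin \<theta> * \<bar>sin ((real N + 1) * \<theta>)\<bar>)"
proof -
  define x where "x n = v (int n)" for n
  define g where "g n = lap v (int n) - complex_of_real (2 - 2 * cos \<theta>) * v (int n)" for n
  define A where "A = \<bar>sin ((real N + 1) * \<theta>)\<bar>"
  have F0: "F \<ge> 0" using order_trans[OF norm_ge_zero F[OF j]] .
  have A: "0 < A" "A \<le> 1" using s by (auto simp: A_def)
  have sol: "sin \<theta> * x n = x 1 * sin (real n * \<theta>) - (\<Sum>m\<in>{1..<n}. g m * sin ((real n - real m) * \<theta>))" for n
  proof (rule recurrence_solution)
    show "x 0 = 0" using E_space_zero[OF v] by (simp add: x_def)
    show "x (n + 2) = 2 * cos \<theta> * x (n + 1) - x n - g (n + 1)" for n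
      by (simp add: x_def g_def lap_def algebra_simps)
  qed
  have S: "cmod (\<Sum>m\<in>{1..<n}. g m * sin ((real n - real m) * \<theta>)) \<le> (real N + 1) * F" if "n \<le> N + 1" for n
  proof -
    have "cmod (\<Sum>m\<in>{1..<n}. g m * sin ((real n - real m) * \<theta>)) \<le> (\<Sum>m\<in>{1..<n}. F)"
    proof (rule sum_norm_le)
      fix m assume "m \<in> {1..<n}"
      then have "cmod (g m) \<le> F" using F[of "int m"] that by (auto simp: g_def)
      then have "cmod (g m) * \<bar>sin ((real n - real m) * \<theta>)\<bar> \<le> F * 1"
        using F0 by (intro mult_mono) auto
      then show "cmod (g m * sin ((real n - real m) * \<theta>)) \<le> F" by (simp add: norm_mult)
    qed
    also have "\<dots> \<le> (real N + 1) * F" using that F0 by (auto intro!: mult_right_mono)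
    finally show ?thesis .
  qed
  have "x (N + 1) = 0" using E_space_zero(2)[OF v] by (simp add: x_def add.commute)
  then have "x 1 * sin (real (N + 1) * \<theta>) = (\<Sum>m\<in>{1..<N+1}. g m * sin ((real (N+1) - real m) * \<theta>))"
    using sol[of "N + 1"] by simp
  then have "cmod (x 1 * sin (real (N + 1) * \<theta>)) \<le> (real N + 1) * F" using S[of "N + 1"] by simp
  then have x1: "cmod (x 1) \<le> (real N + 1) * F / A"
    using A by (simp add: norm_mult A_def field_simps)
  define n where "n = nat j"
  have n: "n \<le> N + 1" "v j = x n" using j by (auto simp: n_def x_def)
  have sp: "sin \<theta> > 0" using \<theta> by (rule sin_gt_zero)
  have "sin \<theta> * cmod (x n) = cmod (sin \<theta> * x n)" using sp by (simp add: norm_mult)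
  also have "\<dots> \<le> cmod (x 1 * sin (real n * \<theta>)) + (real N + 1) * F"
    unfolding sol[of n] by (rule order_trans[OF norm_triangle_ineq4 add_left_mono[OF S[OF n(1)]]])
  finally have "sin \<theta> * cmod (x n) \<le> cmod (x 1 * sin (real n * \<theta>)) + (real N + 1) * F" .
  moreover have "cmod (x 1 * sin (real n * \<theta>)) \<le> (real N + 1) * F / A * 1"
    unfolding norm_mult by (intro mult_mono x1) (use F0 A in auto)
  moreover have "(real N + 1) * F \<le> (real N + 1) * F / A"
    using A F0 by (simp add: pos_le_divide_eq mult_left_le)
  ultimately have "sin \<theta> * cmod (x n) \<le> (real N + 1) * F / A + (real N + 1) * F / A"
    unfolding mult_1_right by (rule order_trans[OF _ add_mono])
  then have "sin \<theta> * cmod (x n) \<le> 2 * (real N + 1) * F / A"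
    by (simp add: add_divide_distrib[symmetric] algebra_simps)
  then show ?thesis using sp A unfolding n(2) A_def[symmetric] by (simp add: field_simps)
qed

text \<open>The partial fraction decomposition of \<open>1 / \<Prod> (x - \<beta>)\<close> with simple poles, multiplied out. To add the
  pole \<open>\<gamma>\<close>, each old term is split by \<open>(\<alpha> - \<gamma>) = (x - \<gamma>) - (x - \<alpha>)\<close>.\<close>
lemma partial_fractions_one:
  fixes R :: "'a::field set"
  assumes "finite R" "R \<noteq> {}"
  shows "\<exists>c. (\<Sum>\<alpha>\<in>R. Polynomial.smult (c \<alpha>) (\<Prod>\<beta>\<in>R - {\<alpha>}. [:- \<beta>, 1:])) = 1"
  using assms
proof (induction rule: finite_ne_induct)
  case (singleton x)
  show ?case by (rule exI[of _ "\<lambda>_. 1"]) simp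
next
  case (insert \<gamma> R)
  then obtain c where c: "(\<Sum>\<alpha>\<in>R. Polynomial.smult (c \<alpha>) (\<Prod>\<beta>\<in>R - {\<alpha>}. [:- \<beta>, 1:])) = 1" by blast
  define P where "P = (\<Prod>\<beta>\<in>R. [:- \<beta>, 1:])"
  define c' where "c' \<alpha> = (if \<alpha> = \<gamma> then - (\<Sum>\<alpha>\<in>R. c \<alpha> / (\<alpha> - \<gamma>)) else c \<alpha> / (\<alpha> - \<gamma>))" for \<alpha>
  have each: "Polynomial.smult (c \<alpha>) (\<Prod>\<beta>\<in>R - {\<alpha>}. [:- \<beta>, 1:])
     = Polynomial.smult (c \<alpha> / (\<alpha> - \<gamma>)) (\<Prod>\<beta>\<in>insert \<gamma> R - {\<alpha>}. [:- \<beta>, 1:]) - Polynomial.smult (c \<alpha> / (\<alpha> - \<gamma>)) P"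
    if \<alpha>: "\<alpha> \<in> R" for \<alpha>
  proof -
    have ne: "\<alpha> \<noteq> \<gamma>" using \<alpha> insert.hyps by auto
    let ?Q = "\<Prod>\<beta>\<in>R - {\<alpha>}. [:- \<beta>, 1:]"
    have 1: "P = [:- \<alpha>, 1:] * ?Q" unfolding P_def using insert.hyps \<alpha> by (intro prod.remove) auto
    have "insert \<gamma> R - {\<alpha>} = insert \<gamma> (R - {\<alpha>})" using ne by auto
    then have 2: "(\<Prod>\<beta>\<in>insert \<gamma> R - {\<alpha>}. [:- \<beta>, 1:]) = [:- \<gamma>, 1:] * ?Q" using insert.hyps by simp
    have "[:- \<gamma>, 1:] * ?Q - P = ([:- \<gamma>, 1:] - [:- \<alpha>, 1:]) * ?Q" unfolding 1 by (simp only: left_diff_distrib)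
    also have "\<dots> = Polynomial.smult (\<alpha> - \<gamma>) ?Q" by simp
    finally have "Polynomial.smult (c \<alpha> / (\<alpha> - \<gamma>)) ([:- \<gamma>, 1:] * ?Q - P) = Polynomial.smult (c \<alpha>) ?Q"
      using ne by simp
    then show ?thesis unfolding 2 by (simp only: smult_diff_right)
  qed
  have "1 = (\<Sum>\<alpha>\<in>R. Polynomial.smult (c \<alpha> / (\<alpha> - \<gamma>)) (\<Prod>\<beta>\<in>insert \<gamma> R - {\<alpha>}. [:- \<beta>, 1:]))
     - Polynomial.smult (\<Sum>\<alpha>\<in>R. c \<alpha> / (\<alpha> - \<gamma>)) P"
    unfolding c[symmetric] smult_sum sum_subtractf[symmetric] by (rule sum.cong[OF refl each])
  also have "(\<Sum>\<alpha>\<in>R. Polynomial.smult (c \<alpha> / (\<alpha> - \<gamma>)) (\<Prod>\<beta>\<in>insert \<gamma> R - {\<alpha>}. [:- \<beta>, 1:]))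
     = (\<Sum>\<alpha>\<in>R. Polynomial.smult (c' \<alpha>) (\<Prod>\<beta>\<in>insert \<gamma> R - {\<alpha>}. [:- \<beta>, 1:]))"
    using insert.hyps by (intro sum.cong) (auto simp: c'_def)
  also have "P = (\<Prod>\<beta>\<in>insert \<gamma> R - {\<gamma>}. [:- \<beta>, 1:])" using insert.hyps by (simp add: P_def)
  finally have "(\<Sum>\<alpha>\<in>insert \<gamma> R. Polynomial.smult (c' \<alpha>) (\<Prod>\<beta>\<in>insert \<gamma> R - {\<alpha>}. [:- \<beta>, 1:])) = 1"
    using insert.hyps by (simp add: c'_def)
  then show ?case by blast
qed

text \<open>The inverse of \<open>L - \<alpha>\<close> on \<open>E_space N\<close> has maximum norm at most \<open>K \<eta>_N\<close>, uniformly in \<open>N\<close>.\<close>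
definition resolvent_bound :: "(nat \<Rightarrow> real) \<Rightarrow> complex \<Rightarrow> real \<Rightarrow> bool" where
  "resolvent_bound \<eta> \<alpha> K \<longleftrightarrow> (\<forall>N\<ge>1. \<forall>v\<in>E_space N. \<forall>F.
     (\<forall>j\<in>{1..int N}. cmod (lap v j - \<alpha> * v j) \<le> F) \<longrightarrow> (\<forall>j\<in>{1..int N}. cmod (v j) \<le> K * \<eta> N * F))"

text \<open>Three regimes: \<open>\<alpha>\<close> off the segment \<open>[0,4]\<close>, \<open>\<alpha> = 0\<close>, and \<open>\<alpha> = 2 - 2 cos \<theta>\<close> with \<open>0 < \<theta> < \<pi>\<close>. Excluding
  the end point 4 keeps \<open>sin \<theta>\<close> away from 0 in the last one.\<close>
lemma ex_resolvent_bound: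
  assumes \<eta>: "\<And>N. N \<ge> 1 \<Longrightarrow> \<eta> N > 0" and A: "A > 0" "\<And>N. N \<ge> 1 \<Longrightarrow> (real N + 1)\<^sup>2 \<le> A * \<eta> N"
    and \<alpha>4: "\<alpha> \<noteq> 4"
    and dioph: "\<And>\<theta>. 0 < \<theta> \<Longrightarrow> \<theta> < pi \<Longrightarrow> \<alpha> = complex_of_real (2 - 2 * cos \<theta>) \<Longrightarrow>
       \<exists>c>0. \<forall>N\<ge>1. c * (real N + 1) \<le> \<eta> N * \<bar>sin ((real N + 1) * \<theta>)\<bar>"
  shows "\<exists>K\<ge>0. resolvent_bound \<eta> \<alpha> K"
proof (cases "\<alpha> \<in> complex_of_real ` {0..4}")
  case False
  then obtain z where z: "z \<noteq> 0" "cmod z < 1" "2 - \<alpha> = z + 1 / z" by (rule resolvent_root)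
  define C where "C = cmod z / (1 - cmod z / 1)\<^sup>2"
  have C: "C \<ge> 0" by (simp add: C_def)
  show ?thesis
  proof (intro exI[of _ "C * A"] conjI)
    show "resolvent_bound \<eta> \<alpha> (C * A)"
      unfolding resolvent_bound_def
    proof (intro allI impI ballI)
      fix N v F j
      assume N: "N \<ge> (1::nat)" and v: "v \<in> E_space N" and F: "\<forall>j\<in>{1..int N}. cmod (lap v j - \<alpha> * v j) \<le> F"
        and j: "j \<in> {1..int N}"
      have F0: "F \<ge> 0" using F j norm_ge_zero order_trans by blast
      have E: "(\<lambda>i. 1 * lap v i + (- \<alpha>) * v i) \<in> E_space N"
        by (rule E_space_linear[OF lap_E_space[OF v] v])
      have "cmod (1 * lap v i + (- \<alpha>) * v i) \<le> F" for i
        by (rule E_space_bound[OF E, where B = "\<lambda>_. F"]) (use F F0 in auto)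
      \<comment> \<open>The constant weight is tempered with rate 1.\<close>
      then have "cmod (v j) \<le> C * F * 1"
        unfolding C_def using z
        by (intro second_order_bound[where W = "\<lambda>_. 1", OF _ E_space_bounded[OF v] z(1) _ z(3)])
           (auto simp: tempered_def intro: exI[of _ 1])
      also have "\<dots> \<le> C * F * (A * \<eta> N)"
      proof (intro mult_left_mono)
        have "1 \<le> (real N + 1)\<^sup>2" by (simp add: one_le_power)
        then show "1 \<le> A * \<eta> N" using A(2)[OF N] by linarith
      qed (use C F0 in auto)
      finally show "cmod (v j) \<le> C * A * \<eta> N * F" by (simp add: ac_simps)
    qed
  qed (use C A in auto)
next
  case True
  then obtain a where a: "\<alpha> = complex_of_real a" "0 \<le> a" "a \<le> 4" by auto
  with \<alpha>4 have a4: "a \<noteq> 4" by auto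
  show ?thesis
  proof (cases "a = 0")
    case True
    have "resolvent_bound \<eta> \<alpha> A"
      unfolding resolvent_bound_def
    proof (intro allI impI ballI)
      fix N v F j
      assume N: "N \<ge> (1::nat)" and v: "v \<in> E_space N" and F: "\<forall>j\<in>{1..int N}. cmod (lap v j - \<alpha> * v j) \<le> F"
        and j: "j \<in> {1..int N}"
      have F0: "F \<ge> 0" using F j norm_ge_zero order_trans by blast
      have "cmod (v j) \<le> (real N + 1)\<^sup>2 * F"
        by (rule lap_inverse_bound[OF v _ N j]) (use F True a in auto)
      also have "\<dots> \<le> A * \<eta> N * F" by (rule mult_right_mono[OF A(2)[OF N] F0])
      finally show "cmod (v j) \<le> A * \<eta> N * F" .
    qed
    then show ?thesis using A by (intro exI[of _ A]) auto
  next
    case False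
    define \<theta> where "\<theta> = arccos (1 - a / 2)"
    have \<theta>: "0 < \<theta>" "\<theta> < pi" using a a4 False arccos_lt_bounded[of "1 - a / 2"] by (auto simp: \<theta>_def)
    have \<alpha>: "\<alpha> = complex_of_real (2 - 2 * cos \<theta>)" using a by (simp add: \<theta>_def cos_arccos)
    obtain c where c: "c > 0" "\<And>N. N \<ge> 1 \<Longrightarrow> c * (real N + 1) \<le> \<eta> N * \<bar>sin ((real N + 1) * \<theta>)\<bar>"
      using dioph[OF \<theta> \<alpha>] by blast
    have sp: "sin \<theta> > 0" using \<theta> by (rule sin_gt_zero)
    have "resolvent_bound \<eta> \<alpha> (2 / (c * sin \<theta>))"
      unfolding resolvent_bound_def
    proof (intro allI impI ballI)
      fix N v F j
      assume N: "N \<ge> (1::nat)" and v: "v \<in> E_space N" and F: "\<forall>j\<in>{1..int N}. cmod (lap v j - \<alpha> * v j) \<le> F"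
        and j: "j \<in> {1..int N}"
      have F0: "F \<ge> 0" using F j norm_ge_zero order_trans by blast
      have "c * (real N + 1) > 0" using c by simp
      then have s: "sin ((real N + 1) * \<theta>) \<noteq> 0" using c(2)[OF N] by auto
      have "cmod (v j) \<le> 2 * (real N + 1) * F / (sin \<theta> * \<bar>sin ((real N + 1) * \<theta>)\<bar>)"
        by (rule oscillating_inverse_bound[OF v \<theta> s _ j]) (use F \<alpha> in auto)
      also have "\<dots> = 2 * F / (c * sin \<theta>) * (c * (real N + 1) / \<bar>sin ((real N + 1) * \<theta>)\<bar>)"
        using c(1) by simp
      also have "\<dots> \<le> 2 * F / (c * sin \<theta>) * \<eta> N"
        using c F0 sp s c(2)[OF N] by (intro mult_left_mono) (auto simp: pos_divide_le_eq)
      finally show "cmod (v j) \<le> 2 / (c * sin \<theta>) * \<eta> N * F" by (simp add: ac_simps)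
    qed
    then show ?thesis using c sp by (intro exI[of _ "2 / (c * sin \<theta>)"]) auto
  qed
qed

text \<open>Writing \<open>p = a \<Prod> (x - \<alpha>)\<close>, the partial fraction identity gives \<open>w = \<Sum> c_\<alpha> v_\<alpha>\<close> where \<open>v_\<alpha>\<close> solves
  \<open>(L - \<alpha>) v_\<alpha> = T_d w / a\<close>. Treating the factors successively instead would multiply their norms
  and lose powers of \<open>N\<close>.\<close>
lemma lower_bound_simple_roots:
  assumes d: "d \<in> coeff_space l" and p: "rsquarefree (symbol l d)" and p4: "poly (symbol l d) 4 \<noteq> 0"
    and \<eta>: "\<And>N. N \<ge> 1 \<Longrightarrow> \<eta> N > 0" and A: "A > 0" "\<And>N. N \<ge> 1 \<Longrightarrow> (real N + 1)\<^sup>2 \<le> A * \<eta> N"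
    and dioph: "\<And>\<theta>. 0 < \<theta> \<Longrightarrow> \<theta> < pi \<Longrightarrow> poly (symbol l d) (complex_of_real (2 - 2 * cos \<theta>)) = 0 \<Longrightarrow>
       \<exists>c>0. \<forall>N\<ge>1. c * (real N + 1) \<le> \<eta> N * \<bar>sin ((real N + 1) * \<theta>)\<bar>"
  shows "\<exists>c>0. \<forall>N\<ge>1. lower_bound c (\<lambda>_. \<eta> N) N d"
proof -
  define p where "p = symbol l d"
  define R where "R = {z. poly p z = 0}"
  define a where "a = lead_coeff p"
  have pn0: "p \<noteq> 0" using p4 by (auto simp: p_def)
  have finR: "finite R" unfolding R_def using pn0 by (rule poly_roots_finite)
  have a0: "a \<noteq> 0" using pn0 by (simp add: a_def)
  define P where "P = (\<Prod>z\<in>R. [:- z, 1:])"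
  have pP: "p = Polynomial.smult a P"
    using complex_poly_decompose_rsquarefree[of p] p by (simp add: p_def a_def P_def R_def)
  obtain q where "p = pCons 0 q" using symbol_eq_pCons_0[OF d] p_def by metis
  then have "0 \<in> R" by (simp add: R_def)
  then have Rne: "R \<noteq> {}" by auto
  obtain c where c: "(\<Sum>\<alpha>\<in>R. Polynomial.smult (c \<alpha>) (\<Prod>\<beta>\<in>R - {\<alpha>}. [:- \<beta>, 1:])) = 1"
    using partial_fractions_one[OF finR Rne] by blast
  have "\<exists>K\<ge>0. resolvent_bound \<eta> \<alpha> K" if "\<alpha> \<in> R" for \<alpha>
  proof (rule ex_resolvent_bound[OF \<eta> A])
    show "\<alpha> \<noteq> 4" using that p4 by (auto simp: R_def p_def)
  qed (use that dioph in \<open>auto simp: R_def p_def\<close>)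
  then obtain K where K: "\<And>\<alpha>. \<alpha> \<in> R \<Longrightarrow> K \<alpha> \<ge> 0" "\<And>\<alpha>. \<alpha> \<in> R \<Longrightarrow> resolvent_bound \<eta> \<alpha> (K \<alpha>)" by metis
  \<comment> \<open>The summand 1 only ensures positivity.\<close>
  define C where "C = 1 + (\<Sum>\<alpha>\<in>R. cmod (c \<alpha>) * K \<alpha>) / cmod a"
  have C: "C > 0" unfolding C_def using K by (intro add_pos_nonneg divide_nonneg_nonneg sum_nonneg) auto
  show ?thesis
  proof (intro exI[of _ "1 / C"] conjI allI impI)
    show pos: "1 / C > 0" using C by simp
    fix N :: nat assume N: "N \<ge> 1"
    show "lower_bound (1 / C) (\<lambda>_. \<eta> N) N d"
    proof (rule lower_boundI[OF pos N])
      show "\<eta> N \<ge> 0" using \<eta>[OF N] by simp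
      fix w M i
      assume w: "w \<in> E_space N" and M: "0 \<le> M" and i: "i \<in> {1..N}"
        and le: "\<And>j. j \<in> {1..N} \<Longrightarrow> \<eta> N * cmod (T_op d w (int j)) \<le> M"
      have f: "poly_lap P w j = T_op d w j / a" for j
        using a0 by (simp add: T_op_eq_poly_lap[OF d] p_def[symmetric] pP poly_lap_smult)
      have fP: "cmod (poly_lap P w j) \<le> M / (\<eta> N * cmod a)" if "j \<in> {1..int N}" for j
      proof -
        have "nat j \<in> {1..N}" "int (nat j) = j" using that by auto
        then have "\<eta> N * cmod (T_op d w j) \<le> M" using le[of "nat j"] by metis
        then show ?thesis using \<eta>[OF N] a0 by (simp add: f norm_divide field_simps)
      qed
      define v where "v \<alpha> = poly_lap (\<Prod>\<beta>\<in>R - {\<alpha>}. [:- \<beta>, 1:]) w" for \<alpha>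
      have vb: "cmod (v \<alpha> (int i)) \<le> K \<alpha> * (M / cmod a)" if \<alpha>: "\<alpha> \<in> R" for \<alpha>
      proof -
        have "P = [:- \<alpha>, 1:] * (\<Prod>\<beta>\<in>R - {\<alpha>}. [:- \<beta>, 1:])"
          unfolding P_def using finR \<alpha> by (rule prod.remove)
        then have "lap (v \<alpha>) j - \<alpha> * v \<alpha> j = poly_lap P w j" for j
          by (simp add: v_def poly_lap_mult poly_lap_linear del: mult_pCons_left)
        moreover have "v \<alpha> \<in> E_space N" unfolding v_def by (rule poly_lap_E_space[OF w])
        moreover have "\<forall>j\<in>{1..int N}. cmod (lap (v \<alpha>) j - \<alpha> * v \<alpha> j) \<le> M / (\<eta> N * cmod a)"
          using fP calculation(1) by simp
        moreover have "int i \<in> {1..int N}" using i by simp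
        ultimately have "cmod (v \<alpha> (int i)) \<le> K \<alpha> * \<eta> N * (M / (\<eta> N * cmod a))"
          using K(2)[OF \<alpha>] N unfolding resolvent_bound_def by blast
        also have "\<dots> = K \<alpha> * (M / cmod a)" using \<eta>[OF N] by simp
        finally show ?thesis .
      qed
      have "w (int i) = poly_lap 1 w (int i)" by simp
      also have "\<dots> = (\<Sum>\<alpha>\<in>R. c \<alpha> * v \<alpha> (int i))"
        unfolding c[symmetric] by (simp only: poly_lap_sum poly_lap_smult v_def)
      finally have ws: "w (int i) = (\<Sum>\<alpha>\<in>R. c \<alpha> * v \<alpha> (int i))" .
      have "cmod (w (int i)) \<le> (\<Sum>\<alpha>\<in>R. cmod (c \<alpha>) * K \<alpha> * (M / cmod a))"
        unfolding ws
      proof (rule sum_norm_le)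
        show "cmod (c \<alpha> * v \<alpha> (int i)) \<le> cmod (c \<alpha>) * K \<alpha> * (M / cmod a)" if "\<alpha> \<in> R" for \<alpha>
          unfolding norm_mult mult.assoc by (intro mult_left_mono vb that) simp
      qed
      also have "\<dots> \<le> C * M"
        using M by (simp add: C_def sum_distrib_right sum_divide_distrib distrib_right)
      finally show "1 / C * cmod (w (int i)) \<le> M" using C by (simp add: field_simps)
    qed
  qed
qed

section \<open>From the matrices to the convolution operators\<close>

lemma is_D_mat_D_mat: "d \<in> sym_seqs \<Longrightarrow> is_D_mat N d (D_mat N d)"
  unfolding D_mat_def by (rule theI'[OF ex1_D_mat])

text \<open>Basis vectors are delta functions on the grid, so a coordinate vector is the restriction to the grid
  of the element of \<open>E_space N\<close> that it represents, and the same holds for its image.\<close>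
lemma D_mat_as_T_op:
  assumes d: "d \<in> sym_seqs" and v: "v \<in> carrier_vec N"
  obtains w where "w \<in> E_space N" "\<And>i. i < N \<Longrightarrow> v $ i = w (int (Suc i))"
    "\<And>i. i < N \<Longrightarrow> (D_mat N d *\<^sub>v v) $ i = T_op d w (int (Suc i))"
proof -
  define A where "A = D_mat N d"
  have "is_D_mat N d A" unfolding A_def by (rule is_D_mat_D_mat[OF d])
  then have A: "A \<in> carrier_mat N N" and col: "\<And>j m. j \<in> {1..N} \<Longrightarrow>
      T_op d (B_basis N j) m = (\<Sum>i=1..N. A $$ (i - 1, j - 1) * B_basis N i m)"
    by (auto simp: is_D_mat_def)
  define w where "w m = (\<Sum>j=1..N. v $ (j - 1) * B_basis N j m)" for m
  have "w \<in> E_space N"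
  proof -
    have "B_basis N i (- m) = - B_basis N i m"
      "B_basis N i (int N + 1 + m) = - B_basis N i (int N + 1 - m)" for i m
      using B_basis_in_E_space[of N i] by (auto simp: E_space_def)
    then show ?thesis
      unfolding E_space_def mem_Collect_eq w_def by (simp only: mult_minus_right sum_negf) simp
  qed
  moreover have delta: "(\<Sum>j=1..N. a j * B_basis N j (int (Suc i))) = a (Suc i)" if "i < N" for a i
  proof -
    have "(\<Sum>j=1..N. a j * B_basis N j (int (Suc i))) = (\<Sum>j=1..N. if j = Suc i then a j else 0)"
      by (intro sum.cong refl) (subst B_basis_delta, use that in auto)
    also have "\<dots> = a (Suc i)" using that by simp
    finally show ?thesis .
  qed
  have "v $ i = w (int (Suc i))" if "i < N" for i
    unfolding w_def delta[OF that] by simp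
  moreover have "(A *\<^sub>v v) $ i = T_op d w (int (Suc i))" if i: "i < N" for i
  proof -
    have "T_op d w (int (Suc i)) = (\<Sum>j=1..N. v $ (j - 1) * T_op d (B_basis N j) (int (Suc i)))"
      unfolding T_op_def w_def sum_distrib_left by (subst sum.swap) (simp add: mult.left_commute)
    also have "\<dots> = (\<Sum>j=1..N. v $ (j - 1) * A $$ (i, j - 1))"
    proof (rule sum.cong[OF refl])
      fix j assume "j \<in> {1..N}"
      show "v $ (j - 1) * T_op d (B_basis N j) (int (Suc i)) = v $ (j - 1) * A $$ (i, j - 1)"
        unfolding col[OF \<open>j \<in> {1..N}\<close>] delta[OF i] by simp
    qed
    also have "\<dots> = (\<Sum>j<N. v $ j * A $$ (i, j))"
      by (rule sum.reindex_bij_witness[of _ Suc "\<lambda>j. j - 1"]) auto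
    also have "\<dots> = (A *\<^sub>v v) $ i"
      using A v i by (auto simp: scalar_prod_def mult.commute lessThan_atLeast0 intro!: sum.cong)
    finally show ?thesis by simp
  qed
  ultimately show ?thesis using that unfolding A_def by blast
qed

lemma vec_norm_inf_attained:
  assumes "v \<in> carrier_vec N" "N \<ge> 1"
  obtains i where "i < N" "vec_norm_inf v = cmod (v $ i)"
proof -
  have "{..<N} \<noteq> {}" using assms(2) by (metis lessThan_empty_iff not_one_le_zero bot_nat_def)
  then have "Max ((\<lambda>i. cmod (v $ i)) ` {..<N}) \<in> (\<lambda>i. cmod (v $ i)) ` {..<N}"
    by (intro Max_in) auto
  then show ?thesis using that assms by (auto simp: vec_norm_inf_def)
qed

lemma strongly_stableI:
  assumes d: "d \<in> sym_seqs" and lb: "\<And>r. \<exists>c>0. \<forall>N\<ge>1. lower_bound c (weight r N) N d"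
  shows "strongly_stable (\<lambda>N. D_mat N d)"
  unfolding strongly_stable_def
proof (intro allI)
  fix r
  obtain c where c: "c > 0" "\<And>N. N \<ge> 1 \<Longrightarrow> lower_bound c (weight r N) N d" using lb by blast
  show "\<exists>c>0. \<forall>N\<ge>1. \<forall>v\<in>carrier_vec N.
        c * vec_norm_inf v \<le> Max ((\<lambda>j. weight r N j * cmod ((D_mat N d *\<^sub>v v) $ (j - 1))) ` {1..N})"
  proof (intro exI[of _ c] conjI c(1) allI impI ballI)
    fix N :: nat and v :: "complex vec" assume N: "N \<ge> 1" and v: "v \<in> carrier_vec N"
    obtain w where w: "w \<in> E_space N" "\<And>i. i < N \<Longrightarrow> v $ i = w (int (Suc i))"
      "\<And>i. i < N \<Longrightarrow> (D_mat N d *\<^sub>v v) $ i = T_op d w (int (Suc i))"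
      using D_mat_as_T_op[OF d v] by blast
    obtain i where i: "i < N" "vec_norm_inf v = cmod (v $ i)" using vec_norm_inf_attained[OF v N] .
    obtain j where j: "j \<in> {1..N}" "c * cmod (w (int (Suc i))) \<le> weight r N j * cmod (T_op d w (int j))"
      using c(2)[OF N] w(1) i(1) unfolding lower_bound_def by (metis Suc_leI atLeastAtMost_iff le_add1 plus_1_eq_Suc)
    have "c * vec_norm_inf v \<le> weight r N j * cmod ((D_mat N d *\<^sub>v v) $ (j - 1))"
      using j w(2)[OF i(1)] w(3)[of "j - 1"] i(2) by auto
    also have "\<dots> \<le> Max ((\<lambda>j. weight r N j * cmod ((D_mat N d *\<^sub>v v) $ (j - 1))) ` {1..N})"
      using j(1) by (intro Max_ge) auto
    finally show "c * vec_norm_inf v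
        \<le> Max ((\<lambda>j. weight r N j * cmod ((D_mat N d *\<^sub>v v) $ (j - 1))) ` {1..N})" .
  qed
qed

lemma stable_relativelyI:
  assumes d: "d \<in> sym_seqs" and \<eta>: "\<And>N. N \<ge> 1 \<Longrightarrow> \<eta> N > 0"
    and lb: "\<exists>c>0. \<forall>N\<ge>1. lower_bound c (\<lambda>_. \<eta> N) N d"
  shows "stable_relatively (\<lambda>N. D_mat N d) \<eta>"
  unfolding stable_relatively_def
proof -
  obtain c where c: "c > 0" "\<And>N. N \<ge> 1 \<Longrightarrow> lower_bound c (\<lambda>_. \<eta> N) N d" using lb by blast
  show "\<exists>c>0. \<forall>N\<ge>1. \<forall>v\<in>carrier_vec N. c * vec_norm_inf v \<le> \<eta> N * vec_norm_inf (D_mat N d *\<^sub>v v)"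
  proof (intro exI[of _ c] conjI c(1) allI impI ballI)
    fix N :: nat and v :: "complex vec" assume N: "N \<ge> 1" and v: "v \<in> carrier_vec N"
    obtain w where w: "w \<in> E_space N" "\<And>i. i < N \<Longrightarrow> v $ i = w (int (Suc i))"
      "\<And>i. i < N \<Longrightarrow> (D_mat N d *\<^sub>v v) $ i = T_op d w (int (Suc i))"
      using D_mat_as_T_op[OF d v] by blast
    obtain i where i: "i < N" "vec_norm_inf v = cmod (v $ i)" using vec_norm_inf_attained[OF v N] .
    obtain j where j: "j \<in> {1..N}" "c * cmod (w (int (Suc i))) \<le> \<eta> N * cmod (T_op d w (int j))"
      using c(2)[OF N] w(1) i(1) unfolding lower_bound_def by (metis Suc_leI atLeastAtMost_iff le_add1 plus_1_eq_Suc)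
    have "D_mat N d \<in> carrier_mat N N"
      using is_D_mat_D_mat[OF d] unfolding is_D_mat_def by blast
    then have dim: "dim_vec (D_mat N d *\<^sub>v v) = N" by simp
    have "c * vec_norm_inf v \<le> \<eta> N * cmod ((D_mat N d *\<^sub>v v) $ (j - 1))"
      using j w(2)[OF i(1)] w(3)[of "j - 1"] i(2) by auto
    also have "\<dots> \<le> \<eta> N * vec_norm_inf (D_mat N d *\<^sub>v v)"
      unfolding vec_norm_inf_def dim using j(1) \<eta>[OF N] by (intro mult_left_mono Max_ge) auto
    finally show "c * vec_norm_inf v \<le> \<eta> N * vec_norm_inf (D_mat N d *\<^sub>v v)" .
  qed
qed

section \<open>Null sets in finite products of the line\<close>

abbreviation lborel_power :: "nat \<Rightarrow> (nat \<Rightarrow> real) measure" where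
  "lborel_power k \<equiv> (\<Pi>\<^sub>M i\<in>{..<k}. (lborel :: real measure))"

lemma space_lborel_power: "space (lborel_power k) = {..<k} \<rightarrow>\<^sub>E UNIV"
  by (simp add: space_PiM)

lemma sigma_finite_lborel_power: "sigma_finite_measure (lborel_power k)"
proof -
  interpret finite_product_sigma_finite "\<lambda>_::nat. lborel :: real measure" "{..<k}"
    by standard auto
  show ?thesis ..
qed

text \<open>Both sides agree on boxes, by translation invariance in each coordinate.\<close>
lemma distr_lborel_power_translation:
  "distr (lborel_power k) (lborel_power k) (\<lambda>x. \<lambda>i\<in>{..<k}. x i + a i) = lborel_power k"
proof -
  interpret product_sigma_finite "\<lambda>_::nat. lborel :: real measure" by standard
  have meas: "(\<lambda>x. \<lambda>i\<in>{..<k}. x i + a i) \<in> measurable (lborel_power k) (lborel_power k)"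
    by measurable
  show ?thesis
  proof (rule PiM_eqI)
    fix A assume A: "\<And>i. i \<in> {..<k} \<Longrightarrow> A i \<in> sets (lborel :: real measure)"
    have AE: "Pi\<^sub>E {..<k} A \<in> sets (lborel_power k)" using A by (intro sets_PiM_I_finite) auto
    have sh: "(\<lambda>y. y + a i) -` A i \<in> sets lborel" if "i \<in> {..<k}" for i
    proof -
      have "(\<lambda>y. y + a i) \<in> borel_measurable borel" by measurable
      from measurable_sets[OF this, of "A i"] A[OF that] show ?thesis by simp
    qed
    have "emeasure (distr (lborel_power k) (lborel_power k) (\<lambda>x. \<lambda>i\<in>{..<k}. x i + a i)) (Pi\<^sub>E {..<k} A)
      = emeasure (lborel_power k) ((\<lambda>x. \<lambda>i\<in>{..<k}. x i + a i) -` Pi\<^sub>E {..<k} A \<inter> space (lborel_power k))"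
      by (rule emeasure_distr[OF meas AE])
    also have "(\<lambda>x. \<lambda>i\<in>{..<k}. x i + a i) -` Pi\<^sub>E {..<k} A \<inter> space (lborel_power k)
      = Pi\<^sub>E {..<k} (\<lambda>i. (\<lambda>y. y + a i) -` A i)"
      unfolding space_lborel_power by (auto simp: PiE_iff restrict_def extensional_def)
    also have "emeasure (lborel_power k) \<dots> = (\<Prod>i<k. emeasure lborel ((\<lambda>y. y + a i) -` A i))"
      using sh by (intro emeasure_PiM) auto
    also have "\<dots> = (\<Prod>i<k. emeasure lborel (A i))"
    proof (rule prod.cong[OF refl])
      fix i assume i: "i \<in> {..<k}"
      have "emeasure lborel (A i) = emeasure (distr lborel borel ((+) (a i))) (A i)"
        by (simp add: lborel_distr_plus)
      also have "\<dots> = emeasure lborel ((+) (a i) -` A i \<inter> space lborel)"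
        using A[OF i] by (intro emeasure_distr) auto
      also have "(+) (a i) -` A i \<inter> space lborel = (\<lambda>y. y + a i) -` A i" by (auto simp: add.commute)
      finally show "emeasure lborel ((\<lambda>y. y + a i) -` A i) = emeasure lborel (A i)" by simp
    qed
    finally show "emeasure (distr (lborel_power k) (lborel_power k) (\<lambda>x. \<lambda>i\<in>{..<k}. x i + a i)) (Pi\<^sub>E {..<k} A)
      = (\<Prod>i<k. emeasure lborel (A i))" .
  qed auto
qed

text \<open>If \<open>B\<close> is the exceptional set, the integral over \<open>t\<close> and \<open>x\<close> of the indicator of \<open>x + g t \<in> B\<close> is
  \<open>\<infinity>\<close> times the measure of \<open>B\<close> when \<open>x\<close> is integrated first, by translation invariance, and 0 when \<open>t\<close>
  is integrated first. Allowing every direction for \<open>g t\<close> makes the argument independent of the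
  coordinates.\<close>
lemma AE_lborel_power_by_translates:
  fixes g :: "'b::euclidean_space \<Rightarrow> nat \<Rightarrow> real"
  assumes meas: "{x \<in> space (lborel_power k). P x} \<in> sets (lborel_power k)"
    and g: "\<And>i. i < k \<Longrightarrow> (\<lambda>t. g t i) \<in> borel_measurable borel"
    and ae: "\<And>x. x \<in> {..<k} \<rightarrow>\<^sub>E UNIV \<Longrightarrow> AE t in lborel. P (\<lambda>i\<in>{..<k}. x i + g t i)"
  shows "AE x in lborel_power k. P x"
proof -
  let ?M = "lborel_power k"
  interpret M: sigma_finite_measure ?M by (rule sigma_finite_lborel_power)
  interpret pair_sigma_finite "lborel :: 'b measure" ?M ..
  define B where "B = {x \<in> space ?M. \<not> P x}"
  have B: "B \<in> sets ?M"
  proof -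
    have "B = space ?M - {x \<in> space ?M. P x}" by (auto simp: B_def)
    then show ?thesis using meas by auto
  qed
  define f where "f t x = (\<lambda>i\<in>{..<k}. x i + g t i)" for t x
  have fpair: "(\<lambda>(t, x). f t x) \<in> measurable (lborel \<Otimes>\<^sub>M ?M) ?M"
    unfolding f_def case_prod_beta
  proof (rule measurable_restrict)
    fix i assume i: "i \<in> {..<k}"
    have "(\<lambda>x. x i) \<in> measurable ?M lborel" using i by (rule measurable_component_singleton)
    from measurable_compose[OF measurable_snd[of lborel ?M] this]
    have "(\<lambda>x. snd x i) \<in> borel_measurable (lborel \<Otimes>\<^sub>M ?M)" by simp
    moreover have "(\<lambda>t. g t i) \<in> measurable lborel borel" using g i by simp
    from measurable_compose[OF measurable_fst[of lborel ?M] this]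
    have "(\<lambda>x. g (fst x) i) \<in> borel_measurable (lborel \<Otimes>\<^sub>M ?M)" .
    ultimately have "(\<lambda>x. snd x i + g (fst x) i) \<in> borel_measurable (lborel \<Otimes>\<^sub>M ?M)"
      by (rule borel_measurable_add)
    then show "(\<lambda>x. snd x i + g (fst x) i) \<in> measurable (lborel \<Otimes>\<^sub>M ?M) lborel" by simp
  qed
  have ft: "f t \<in> measurable ?M ?M" for t
    using measurable_compose[OF measurable_Pair1'[of t lborel ?M] fpair] by simp
  have "(\<integral>\<^sup>+ x. (\<integral>\<^sup>+ t. indicator B (f t x) \<partial>lborel) \<partial>?M) = (\<integral>\<^sup>+ t. (\<integral>\<^sup>+ x. indicator B (f t x) \<partial>?M) \<partial>lborel)"
  proof (rule Fubini')
    show "(\<lambda>(t, x). indicator B (f t x)) \<in> borel_measurable (lborel \<Otimes>\<^sub>M ?M)"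
      using measurable_compose[OF fpair borel_measurable_indicator[OF B]] by (simp add: split_beta')
  qed
  also have "(\<integral>\<^sup>+ t. (\<integral>\<^sup>+ x. indicator B (f t x) \<partial>?M) \<partial>lborel) = (\<integral>\<^sup>+ (t::'b). emeasure ?M B \<partial>lborel)"
  proof (rule nn_integral_cong)
    fix t :: 'b
    have "(\<integral>\<^sup>+ x. indicator B (f t x) \<partial>?M) = (\<integral>\<^sup>+ x. indicator B x \<partial>distr ?M ?M (f t))"
      by (rule nn_integral_distr[symmetric, OF ft]) (use B in measurable)
    also have "distr ?M ?M (f t) = ?M" unfolding f_def by (rule distr_lborel_power_translation)
    finally show "(\<integral>\<^sup>+ x. indicator B (f t x) \<partial>?M) = emeasure ?M B" using B by simp
  qed
  also have "\<dots> = emeasure ?M B * \<infinity>" by (simp add: emeasure_lborel_UNIV)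
  finally have *: "(\<integral>\<^sup>+ x. (\<integral>\<^sup>+ t. indicator B (f t x) \<partial>lborel) \<partial>?M) = emeasure ?M B * \<infinity>" .
  have "(\<integral>\<^sup>+ x. (\<integral>\<^sup>+ t. indicator B (f t x) \<partial>lborel) \<partial>?M) = (\<integral>\<^sup>+ x. 0 \<partial>?M)"
  proof (rule nn_integral_cong)
    fix x assume "x \<in> space ?M"
    then have "x \<in> {..<k} \<rightarrow>\<^sub>E UNIV" by (simp add: space_lborel_power)
    from ae[OF this] have "AE t in lborel. indicator B (f t x) = (0::ennreal)"
      by eventually_elim (auto simp: B_def f_def)
    then have "(\<integral>\<^sup>+ t. indicator B (f t x) \<partial>lborel) = (\<integral>\<^sup>+ (t::'b). 0 \<partial>lborel)"
      by (rule nn_integral_cong_AE)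
    then show "(\<integral>\<^sup>+ t. indicator B (f t x) \<partial>lborel) = 0" by simp
  qed
  with * have "emeasure ?M B * \<infinity> = 0" by simp
  then have "emeasure ?M B = 0" by simp
  then have "B \<in> null_sets ?M" using B by (simp add: null_sets_def)
  then show ?thesis by (rule AE_I') (auto simp: B_def)
qed

section \<open>Measurability\<close>

text \<open>The condition is an intersection of finite unions of closed conditions in the parameters, hence
  closed, even though the intersection is over uncountably many \<open>w\<close>. The parameters are extended by 0
  to all indices, where the product of Borel algebras is the Borel algebra of the product.\<close>
lemma lower_bound_measurable:
  fixes \<psi> :: "(nat \<Rightarrow> real) \<Rightarrow> int \<Rightarrow> complex"
  assumes cs: "\<And>x. x \<in> {..<k} \<rightarrow>\<^sub>E UNIV \<Longrightarrow> \<psi> x \<in> coeff_space l"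
    and lin: "\<And>x j. x \<in> {..<k} \<rightarrow>\<^sub>E UNIV \<Longrightarrow> \<psi> x j = (\<Sum>i<k. of_real (x i) * b i j)"
  shows "{x \<in> space (lborel_power k). lower_bound c \<omega> N (\<psi> x)} \<in> sets (lborel_power k)"
proof -
  define U where "U y w m = (\<Sum>j\<in>{- int (Suc l)..int (Suc l)}. (\<Sum>i<k. of_real (y i) * b i j) * w (m - j))"
    for y :: "nat \<Rightarrow> real" and w :: "int \<Rightarrow> complex" and m
  define C where "C = (\<Inter>w\<in>E_space N. \<Inter>i\<in>{1..N}. \<Union>j\<in>{1..N}.
    {y. c * cmod (w (int i)) \<le> \<omega> j * cmod (U y w (int j))})"
  have "closed C"
    unfolding C_def
  proof (intro closed_INT ballI closed_UN)
    fix w :: "int \<Rightarrow> complex" and i j :: nat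
    show "closed {y. c * cmod (w (int i)) \<le> \<omega> j * cmod (U y w (int j))}"
      unfolding U_def by (intro closed_Collect_le continuous_intros continuous_on_product_coordinates)
  qed auto
  then have C: "C \<in> sets (\<Pi>\<^sub>M i\<in>UNIV. borel)" unfolding sets_PiM_equal_borel by (rule borel_closed)
  define e where "e x = (\<lambda>i. if i < k then x i else 0)" for x :: "nat \<Rightarrow> real"
  have e: "e \<in> measurable (lborel_power k) (\<Pi>\<^sub>M i\<in>UNIV. borel)"
  proof (rule measurable_PiM_single')
    fix i :: nat
    show "(\<lambda>x. e x i) \<in> borel_measurable (lborel_power k)"
    proof (cases "i < k")
      case True
      then have "(\<lambda>x. x i) \<in> measurable (lborel_power k) lborel"
        by (intro measurable_component_singleton) auto
      then show ?thesis using True by (simp add: e_def)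
    qed (simp add: e_def)
  qed auto
  have "{x \<in> space (lborel_power k). lower_bound c \<omega> N (\<psi> x)} = e -` C \<inter> space (lborel_power k)"
  proof -
    have "T_op (\<psi> x) w m = U (e x) w m" if "x \<in> {..<k} \<rightarrow>\<^sub>E UNIV" for x w m
      unfolding T_op_interval[OF cs[OF that]] U_def lin[OF that] by (simp add: e_def)
    then show ?thesis
      unfolding space_lborel_power by (auto simp: C_def lower_bound_def)
  qed
  then show ?thesis using measurable_sets[OF e C] by simp
qed

text \<open>A common form of the two stability properties. The constant is restricted to \<open>1 / (n + 1)\<close> to keep
  the quantifiers countable.\<close>
definition bounded_below :: "(nat \<Rightarrow> nat \<Rightarrow> nat \<Rightarrow> real) \<Rightarrow> (int \<Rightarrow> complex) \<Rightarrow> bool" where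
  "bounded_below \<omega> d \<longleftrightarrow> (\<forall>r. \<exists>n::nat. \<forall>N\<ge>1. lower_bound (1 / real (Suc n)) (\<omega> r N) N d)"

lemma lower_bound_antimono:
  assumes "lower_bound c \<omega> N d" "c' \<le> c"
  shows "lower_bound c' \<omega> N d"
  unfolding lower_bound_def
proof (intro ballI)
  fix w i assume "w \<in> E_space N" "i \<in> {1..N}"
  then obtain j where "j \<in> {1..N}" "c * cmod (w (int i)) \<le> \<omega> j * cmod (T_op d w (int j))"
    using assms(1) unfolding lower_bound_def by blast
  moreover have "c' * cmod (w (int i)) \<le> c * cmod (w (int i))"
    using assms(2) by (intro mult_right_mono) auto
  ultimately show "\<exists>j\<in>{1..N}. c' * cmod (w (int i)) \<le> \<omega> j * cmod (T_op d w (int j))" by force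
qed

lemma bounded_below_iff:
  "bounded_below \<omega> d \<longleftrightarrow> (\<forall>r. \<exists>c>0. \<forall>N\<ge>1. lower_bound c (\<omega> r N) N d)"
proof
  assume b: "bounded_below \<omega> d"
  show "\<forall>r. \<exists>c>0. \<forall>N\<ge>1. lower_bound c (\<omega> r N) N d"
  proof
    fix r
    obtain n where "\<forall>N\<ge>1. lower_bound (1 / real (Suc n)) (\<omega> r N) N d"
      using b unfolding bounded_below_def by blast
    then show "\<exists>c>0. \<forall>N\<ge>1. lower_bound c (\<omega> r N) N d" by (intro exI[of _ "1 / real (Suc n)"]) auto
  qed
next
  assume b: "\<forall>r. \<exists>c>0. \<forall>N\<ge>1. lower_bound c (\<omega> r N) N d"
  show "bounded_below \<omega> d"
    unfolding bounded_below_def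
  proof
    fix r
    obtain c where c: "c > 0" "\<And>N. N \<ge> 1 \<Longrightarrow> lower_bound c (\<omega> r N) N d" using b by blast
    obtain n where "1 / real (Suc n) < c" using nat_approx_posE[OF c(1)] .
    then show "\<exists>n. \<forall>N\<ge>1. lower_bound (1 / real (Suc n)) (\<omega> r N) N d"
      using lower_bound_antimono[OF c(2)] by (intro exI[of _ n]) auto
  qed
qed

lemma bounded_below_measurable:
  fixes \<psi> :: "(nat \<Rightarrow> real) \<Rightarrow> int \<Rightarrow> complex"
  assumes cs: "\<And>x. x \<in> {..<k} \<rightarrow>\<^sub>E UNIV \<Longrightarrow> \<psi> x \<in> coeff_space l"
    and lin: "\<And>x j. x \<in> {..<k} \<rightarrow>\<^sub>E UNIV \<Longrightarrow> \<psi> x j = (\<Sum>i<k. of_real (x i) * b i j)"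
  shows "{x \<in> space (lborel_power k). bounded_below \<omega> (\<psi> x)} \<in> sets (lborel_power k)"
  unfolding bounded_below_def
proof (intro sets.sets_Collect_countable_All sets.sets_Collect_countable_Ex)
  fix r n N :: nat
  show "{x \<in> space (lborel_power k). 1 \<le> N \<longrightarrow> lower_bound (1 / real (Suc n)) (\<omega> r N) N (\<psi> x)}
      \<in> sets (lborel_power k)"
    using lower_bound_measurable[OF cs lin] by (cases "1 \<le> N") auto
qed

section \<open>Almost every angle is badly approximable\<close>

lemma abs_sin_ge_third:
  fixes y :: real
  assumes "\<bar>y\<bar> \<le> 2"
  shows "\<bar>y\<bar> / 3 \<le> \<bar>sin y\<bar>"
proof -
  have "(\<Sum>m<3. sin_coeff m * y ^ m) = y"
    by (simp add: sin_coeff_def numeral_3_eq_3)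
  then have "\<bar>sin y - y\<bar> \<le> \<bar>y\<bar> ^ 3 / 6"
    using Maclaurin_sin_bound[of y 3] by (simp add: fact_numeral)
  also have "\<bar>y\<bar> ^ 3 = \<bar>y\<bar> * \<bar>y\<bar>\<^sup>2" by (simp add: power3_eq_cube power2_eq_square)
  also have "\<dots> \<le> \<bar>y\<bar> * 2\<^sup>2" using assms by (intro mult_left_mono power_mono) auto
  finally show ?thesis using abs_triangle_ineq2[of y "sin y"] by (simp add: abs_minus_commute)
qed

text \<open>If \<open>sin x\<close> is small then \<open>x\<close> is close to a multiple of \<open>\<pi>\<close>, namely the nearest one; the second
  inequality locates that multiple.\<close>
lemma near_multiple_of_pi:
  fixes x :: real
  obtains m :: int where "\<bar>x - of_int m * pi\<bar> \<le> 3 * \<bar>sin x\<bar>" "\<bar>of_int m - x / pi\<bar> \<le> 1 / 2"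
proof -
  define m where "m = round (x / pi)"
  have m: "\<bar>of_int m - x / pi\<bar> \<le> 1 / 2" unfolding m_def by (rule of_int_round_abs_le)
  define y where "y = x - of_int m * pi"
  have "y = (x / pi - of_int m) * pi" by (simp add: y_def algebra_simps)
  then have "\<bar>y\<bar> = \<bar>of_int m - x / pi\<bar> * pi" by (simp add: abs_mult abs_minus_commute)
  also have "\<dots> \<le> 1 / 2 * pi" by (intro mult_right_mono m) simp
  also have "\<dots> \<le> 2" using pi_less_4 by simp
  finally have "\<bar>y\<bar> / 3 \<le> \<bar>sin y\<bar>" by (rule abs_sin_ge_third)
  moreover have s: "sin (of_int m * pi) = (0::real)" by (auto simp: sin_zero_iff_int2)
  have "(cos (of_int m * pi :: real))\<^sup>2 = 1" using sin_cos_squared_add[of "of_int m * pi :: real"] s by simp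
  then have "\<bar>cos (of_int m * pi :: real)\<bar> = 1" by (metis abs_1 abs_square_eq_1 power2_abs real_sqrt_abs real_sqrt_one)
  then have "\<bar>sin y\<bar> = \<bar>sin x\<bar>" by (simp add: y_def sin_diff s abs_mult)
  ultimately show ?thesis using that[OF _ m] by (simp add: y_def)
qed

lemma negligible_if_AE:
  fixes P :: "'a::euclidean_space \<Rightarrow> bool"
  assumes "AE x in lborel. P x"
  shows "negligible {x. \<not> P x}"
proof -
  obtain A where "{x \<in> space lborel. \<not> P x} \<subseteq> A" "emeasure lborel A = 0" "A \<in> sets lborel"
    using assms by (rule AE_E)
  then have "A \<in> null_sets lebesgue" "{x. \<not> P x} \<subseteq> A" by (auto simp: null_sets_completionI)
  then show ?thesis using negligible_subset negligible_iff_null_sets by blast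
qed

lemma AE_if_negligible:
  fixes S :: "'a::euclidean_space set"
  assumes "negligible S"
  shows "AE x in lborel. x \<notin> S"
proof -
  have "AE x in lebesgue. x \<notin> S"
    using assms unfolding negligible_iff_null_sets by (rule AE_not_in)
  then show ?thesis by (simp only: AE_completion_iff)
qed

text \<open>A Diophantine condition: up to constants, the distance of \<open>(N + 1) \<theta> / \<pi>\<close> to the integers is at least
  \<open>(N + 1) / \<eta> N\<close>.\<close>
definition badly_approximable :: "(nat \<Rightarrow> real) \<Rightarrow> real \<Rightarrow> bool" where
  "badly_approximable \<eta> \<theta> \<longleftrightarrow> (\<exists>c>0. \<forall>N\<ge>1. c * (real N + 1) \<le> \<eta> N * \<bar>sin ((real N + 1) * \<theta>)\<bar>)"

lemma badly_approximableI:
  assumes \<eta>: "\<And>N. N \<ge> 1 \<Longrightarrow> \<eta> N > 0" and nz: "\<And>N. sin ((real N + 1) * \<theta>) \<noteq> 0"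
    and ev: "\<forall>\<^sub>F N in sequentially. real N + 1 \<le> \<eta> N * \<bar>sin ((real N + 1) * \<theta>)\<bar>"
  shows "badly_approximable \<eta> \<theta>"
proof -
  obtain N0 where N0: "\<And>N. N \<ge> N0 \<Longrightarrow> real N + 1 \<le> \<eta> N * \<bar>sin ((real N + 1) * \<theta>)\<bar>"
    using ev by (auto simp: eventually_sequentially)
  define a where "a N = \<eta> N * \<bar>sin ((real N + 1) * \<theta>)\<bar> / (real N + 1)" for N
  \<comment> \<open>The entry 1 serves all \<open>N\<close> beyond \<open>N0\<close>.\<close>
  define c where "c = Min (insert 1 (a ` {1..N0}))"
  have "c > 0"
    unfolding c_def using \<eta> nz by (subst Min_gr_iff) (auto simp: a_def)
  moreover have "c * (real N + 1) \<le> \<eta> N * \<bar>sin ((real N + 1) * \<theta>)\<bar>" if "N \<ge> 1" for N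
  proof (cases "N \<le> N0")
    case True
    then have "c \<le> a N" unfolding c_def using that by (intro Min_le) auto
    then show ?thesis by (simp add: a_def field_simps)
  next
    case False
    have "c \<le> 1" unfolding c_def by (intro Min_le) auto
    then have "c * (real N + 1) \<le> 1 * (real N + 1)" by (intro mult_right_mono) auto
    also have "\<dots> = real N + 1" by simp
    also have "\<dots> \<le> \<eta> N * \<bar>sin ((real N + 1) * \<theta>)\<bar>" using False by (intro N0) auto
    finally show ?thesis .
  qed
  ultimately show ?thesis unfolding badly_approximable_def by blast
qed

text \<open>With \<open>\<epsilon> N = (N + 1) / \<eta> N\<close>, the set of angles with \<open>\<bar>sin ((N + 1) \<theta>)\<bar> < \<epsilon> N\<close> is covered by \<open>N + 2\<close>
  intervals of radius \<open>3 \<epsilon> N / (N + 1)\<close> around the multiples of \<open>\<pi> / (N + 1)\<close>, of total length at most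
  \<open>12 \<epsilon> N\<close>. Since this is summable, almost every angle lies in finitely many of these sets. Finitely
  many \<open>N\<close> only affect the constant, as long as no sine vanishes.\<close>
lemma negligible_not_badly_approximable:
  assumes \<eta>: "\<And>N. N \<ge> 1 \<Longrightarrow> \<eta> N > 0"
    and sm: "(\<lambda>N. (real N + 1) / \<eta> N) summable_on {1..}"
  shows "negligible {\<theta> \<in> {0<..<pi}. \<not> badly_approximable \<eta> \<theta>}"
proof -
  define \<epsilon> where "\<epsilon> N = (if N \<ge> 1 then (real N + 1) / \<eta> N else 0)" for N :: nat
  have \<epsilon>0: "\<epsilon> N \<ge> 0" for N using \<eta>[of N] by (auto simp: \<epsilon>_def)
  have "\<epsilon> summable_on UNIV"
    using sm by (subst summable_on_cong_neutral[where T = "{1..}" and g = "\<lambda>N. (real N + 1) / \<eta> N"])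
      (auto simp: \<epsilon>_def)
  then have sum_\<epsilon>: "summable \<epsilon>" by (rule summable_on_imp_summable)
  define I where "I N m = cball (real m * pi / (real N + 1)) (3 * \<epsilon> N / (real N + 1))" for N m :: nat
  define A where "A N = (\<Union>m\<in>{..N + 1}. I N m)" for N
  have mI: "Sigma_Algebra.measure lborel (I N m) = 6 * \<epsilon> N / (real N + 1)" for N m
  proof -
    have "0 \<le> \<epsilon> N / (real N + 1)" using \<epsilon>0[of N] by simp
    then show ?thesis using \<epsilon>0[of N] by (simp add: I_def cball_eq_atLeastAtMost)
  qed
  have Aset: "A N \<in> sets lborel" for N by (auto simp: A_def I_def)
  have Afin: "emeasure lborel (A N) < \<infinity>" for N
    by (rule emeasure_bounded_finite) (auto simp: A_def I_def)
  have mA: "Sigma_Algebra.measure lborel (A N) \<le> 12 * \<epsilon> N" for N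
  proof -
    have "Sigma_Algebra.measure lborel (A N) \<le> (\<Sum>m\<in>{..N+1}. Sigma_Algebra.measure lborel (I N m))"
      unfolding A_def by (rule measure_UNION_le) (auto simp: I_def)
    also have "\<dots> = (real N + 2) * (6 * \<epsilon> N / (real N + 1))" by (simp add: mI)
    also have "\<dots> \<le> (2 * (real N + 1)) * (6 * \<epsilon> N / (real N + 1))"
      using \<epsilon>0[of N] by (intro mult_right_mono) auto
    also have "\<dots> = 12 * \<epsilon> N" by (simp add: field_simps)
    finally show ?thesis .
  qed
  have "summable (\<lambda>N. Sigma_Algebra.measure lborel (A N))"
    by (rule summable_comparison_test'[OF summable_mult[OF sum_\<epsilon>, of 12]]) (use mA in auto)
  then have AE1: "AE \<theta> in lborel. \<forall>\<^sub>F N in sequentially. \<theta> \<in> space lborel - A N"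
    by (rule borel_cantelli_AE1[OF Aset Afin])
  \<comment> \<open>The angles at which one of the sines vanishes.\<close>
  define Z where "Z = (\<Union>N::nat. \<Union>m::int. {of_int m * pi / (real N + 1)})"
  have "countable Z" unfolding Z_def by (intro countable_UN countableI_type) simp_all
  then have AE2: "AE \<theta> in lborel. \<theta> \<notin> Z"
    by (intro AE_not_in countable_imp_null_set_lborel)
  have "AE \<theta> in lborel. 0 < \<theta> \<and> \<theta> < pi \<longrightarrow> badly_approximable \<eta> \<theta>"
    using AE1 AE2
  proof eventually_elim
    fix \<theta> assume ev: "\<forall>\<^sub>F N in sequentially. \<theta> \<in> space lborel - A N" and Z: "\<theta> \<notin> Z"
    show "0 < \<theta> \<and> \<theta> < pi \<longrightarrow> badly_approximable \<eta> \<theta>"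
    proof
      assume \<theta>: "0 < \<theta> \<and> \<theta> < pi"
      show "badly_approximable \<eta> \<theta>"
      proof (rule badly_approximableI[OF \<eta>])
        show "sin ((real N + 1) * \<theta>) \<noteq> 0" for N
        proof
          assume "sin ((real N + 1) * \<theta>) = 0"
          then obtain i :: int where "(real N + 1) * \<theta> = of_int i * pi" by (auto simp: sin_zero_iff_int2)
          then have "\<theta> = of_int i * pi / (real N + 1)" by (simp add: field_simps)
          then have "\<theta> \<in> Z" unfolding Z_def by blast
          with Z show False ..
        qed
        show "\<forall>\<^sub>F N in sequentially. real N + 1 \<le> \<eta> N * \<bar>sin ((real N + 1) * \<theta>)\<bar>"
          using ev eventually_ge_at_top[of 1]
        proof eventually_elim
          fix N :: nat assume nA: "\<theta> \<in> space lborel - A N" and N: "1 \<le> N"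
          define M where "M = real N + 1"
          have M: "M > 0" by (simp add: M_def)
          have "\<epsilon> N \<le> \<bar>sin (M * \<theta>)\<bar>"
          proof (rule ccontr)
            assume lt: "\<not> \<epsilon> N \<le> \<bar>sin (M * \<theta>)\<bar>"
            obtain m :: int where m: "\<bar>M * \<theta> - of_int m * pi\<bar> \<le> 3 * \<bar>sin (M * \<theta>)\<bar>"
              "\<bar>of_int m - M * \<theta> / pi\<bar> \<le> 1 / 2" by (rule near_multiple_of_pi)
            have "M * \<theta> / pi > 0" "M * \<theta> / pi < M" using \<theta> M by (auto simp: field_simps)
            then have "of_int m > (-1 :: real)" "of_int m < M + 1" using m(2) by linarith+
            then have "m > -1" "m < int N + 2" unfolding M_def by linarith+
            then have nm: "nat m \<in> {..N + 1}" "real (nat m) = of_int m" by auto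
            have "\<theta> - of_int m * pi / M = (M * \<theta> - of_int m * pi) / M" using M by (simp add: field_simps)
            then have "\<bar>\<theta> - of_int m * pi / M\<bar> = \<bar>M * \<theta> - of_int m * pi\<bar> / M" using M by simp
            also have "\<dots> \<le> 3 * \<epsilon> N / M" using m(1) lt M by (intro divide_right_mono) auto
            finally have "\<theta> \<in> I N (nat m)" unfolding I_def nm(2) M_def by (simp add: dist_real_def abs_minus_commute)
            then show False using nA nm(1) unfolding A_def by blast
          qed
          then show "real N + 1 \<le> \<eta> N * \<bar>sin ((real N + 1) * \<theta>)\<bar>"
            using N \<eta>[OF N] by (simp add: \<epsilon>_def M_def field_simps)
        qed
      qed
    qed
  qed
  from negligible_if_AE[OF this] show ?thesis by (rule negligible_subset) auto
qed

section \<open>Moving a symbol along the discrete Laplacian\<close>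

lemma coeff_space_linear:
  fixes d e :: "int \<Rightarrow> 'a::comm_ring_1"
  assumes "d \<in> coeff_space l" "e \<in> coeff_space l"
  shows "(\<lambda>j. a * d j + b * e j) \<in> coeff_space l"
  using assms unfolding mem_coeff_space_iff by (auto simp: sum.distrib simp flip: sum_distrib_left)

lemma coeff_space_translate:
  fixes d :: "int \<Rightarrow> 'a::comm_ring_1"
  assumes "d \<in> coeff_space l"
  shows "(\<lambda>j. d j + t * lap_seq j) \<in> coeff_space l"
  using coeff_space_linear[OF assms lap_seq_in_coeff_space, of 1 t] by simp

lemma has_vector_derivative_poly_of_real:
  assumes "(f has_real_derivative f') (at x)"
  shows "((\<lambda>x. poly q (complex_of_real (f x))) has_vector_derivative
    complex_of_real f' * poly (pderiv q) (complex_of_real (f x))) (at x)"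
  using field_vector_diff_chain_at[OF has_vector_derivative_of_real[OF assms] poly_DERIV[of q]]
  by (simp add: o_def)

text \<open>The symbol becomes \<open>x (q + t)\<close>, and \<open>q + t\<close> has a root in \<open>[0,4]\<close> only if \<open>t\<close> lies on the curve
  \<open>- q [0,4]\<close>.\<close>
lemma AE_bounded_below_complex_direction:
  assumes d: "d \<in> coeff_space l"
  shows "AE t in lborel. bounded_below weight (\<lambda>j. d j + t * lap_seq j)"
proof -
  obtain q where q: "symbol l d = pCons 0 q" using symbol_eq_pCons_0[OF d] .
  define S where "S = (\<lambda>x::real. - poly q (complex_of_real x)) ` {0..4}"
  have "negligible S"
    unfolding S_def
  proof (rule negligible_differentiable_image_lowdim)
    have "(\<lambda>x::real. poly q (complex_of_real x)) differentiable (at x)" for x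
      by (rule differentiableI_vector[OF has_vector_derivative_poly_of_real[OF DERIV_ident]])
    then have "(\<lambda>x::real. - poly q (complex_of_real x)) differentiable (at x)" for x
      by (rule differentiable_minus)
    then show "(\<lambda>x::real. - poly q (complex_of_real x)) differentiable_on {0..4}"
      by (auto intro: differentiable_at_imp_differentiable_on)
  qed simp
  then have "AE t in lborel. t \<notin> S" by (rule AE_if_negligible)
  then show ?thesis
  proof eventually_elim
    fix t assume t: "t \<notin> S"
    have "symbol l (\<lambda>j. d j + t * lap_seq j) = pCons 0 (q + [:t:])"
      unfolding symbol_add_lap_seq q by simp
    moreover have "poly (q + [:t:]) (complex_of_real x) \<noteq> 0" if "0 \<le> x" "x \<le> 4" for x
    proof
      assume "poly (q + [:t:]) (complex_of_real x) = 0"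
      then have "t = - poly q (complex_of_real x)" by (simp add: add_eq_0_iff)
      then show False using t that unfolding S_def by auto
    qed
    ultimately show "bounded_below weight (\<lambda>j. d j + t * lap_seq j)"
      unfolding bounded_below_iff using lower_bound_strong[OF coeff_space_translate[OF d]] by blast
  qed
qed

text \<open>The symbol becomes \<open>x (q + t)\<close>. A multiple root forces \<open>t = - q z\<close> with \<open>z = 0\<close> or \<open>z\<close> a critical
  point of \<open>q\<close> (when \<open>q\<close> is constant, \<open>z = 0\<close> can be chosen), a root at 4 forces \<open>t = - q 4\<close>, and a root at a
  bad angle \<open>\<theta>\<close> forces \<open>t = - q (2 - 2 cos \<theta>)\<close>, the image of a null set under a smooth
  map. As \<open>t\<close> is real, it is the real part of these values.\<close>
lemma AE_bounded_below_real_direction: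
  assumes d: "d \<in> coeff_space l"
    and \<eta>: "\<And>N. N \<ge> 1 \<Longrightarrow> \<eta> N > 0"
    and sm: "(\<lambda>N. (real N + 1) / \<eta> N) summable_on {1..}"
    and A: "A > 0" "\<And>N. N \<ge> 1 \<Longrightarrow> (real N + 1)\<^sup>2 \<le> A * \<eta> N"
  shows "AE t in lborel. bounded_below (\<lambda>_ N _. \<eta> N) (\<lambda>j. d j + complex_of_real t * lap_seq j)"
proof -
  obtain q where q: "symbol l d = pCons 0 q" using symbol_eq_pCons_0[OF d] .
  \<comment> \<open>A constant \<open>q\<close> makes every point critical, but then its only value is \<open>q 0\<close>.\<close>
  define T where "T = {0, 4} \<union> (if pderiv q = 0 then {} else {z. poly (pderiv q) z = 0})"
  define S1 where "S1 = (\<lambda>z. - Re (poly q z)) ` T"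
  define S2 where "S2 = (\<lambda>\<theta>. - Re (poly q (complex_of_real (2 - 2 * cos \<theta>)))) ` {\<theta> \<in> {0<..<pi}. \<not> badly_approximable \<eta> \<theta>}"
  have "finite T" unfolding T_def by (auto intro: poly_roots_finite)
  then have "negligible S1" unfolding S1_def by (intro negligible_finite finite_imageI)
  moreover have "negligible S2"
    unfolding S2_def
  proof (rule negligible_differentiable_image_negligible[OF order_refl negligible_not_badly_approximable[OF \<eta> sm]])
    have "((\<lambda>\<theta>. 2 - 2 * cos \<theta>) has_real_derivative 2 * sin \<theta>) (at \<theta>)" for \<theta> :: real
      by (auto intro!: derivative_eq_intros)
    from bounded_linear.has_vector_derivative[OF bounded_linear_Re has_vector_derivative_poly_of_real[OF this]]
    have "(\<lambda>\<theta>. Re (poly q (complex_of_real (2 - 2 * cos \<theta>)))) differentiable (at \<theta>)" for \<theta>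
      by (rule differentiableI_vector)
    then have "(\<lambda>\<theta>. - Re (poly q (complex_of_real (2 - 2 * cos \<theta>)))) differentiable (at \<theta>)" for \<theta>
      by (rule differentiable_minus)
    then show "(\<lambda>\<theta>. - Re (poly q (complex_of_real (2 - 2 * cos \<theta>)))) differentiable_on
        {\<theta> \<in> {0<..<pi}. \<not> badly_approximable \<eta> \<theta>}"
      by (auto intro: differentiable_at_imp_differentiable_on)
  qed auto
  ultimately have "negligible (S1 \<union> S2)" by (rule negligible_Un)
  then have "AE t in lborel. t \<notin> S1 \<union> S2" by (rule AE_if_negligible)
  then show ?thesis
  proof eventually_elim
    fix t :: real assume t: "t \<notin> S1 \<union> S2"
    define p where "p = symbol l (\<lambda>j. d j + complex_of_real t * lap_seq j)"
    have p: "p = pCons 0 (q + [:complex_of_real t:])"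
      unfolding p_def symbol_add_lap_seq q by simp
    have root: "t = - Re (poly q z)" if "poly (q + [:complex_of_real t:]) z = 0" for z
    proof -
      have "complex_of_real t = - poly q z" using that by (simp add: add_eq_0_iff)
      from arg_cong[OF this, of Re] show ?thesis by simp
    qed
    have nT: "poly (q + [:complex_of_real t:]) z \<noteq> 0" if "z \<in> T" for z
      using root[of z] that t unfolding S1_def by blast
    have "rsquarefree p"
      unfolding rsquarefree_roots
    proof (intro allI notI, elim conjE)
      fix z assume z: "poly p z = 0" "poly (pderiv p) z = 0"
      have "poly p z = z * poly (q + [:complex_of_real t:]) z" unfolding p by simp
      moreover have dp: "poly (pderiv p) z = poly (q + [:complex_of_real t:]) z + z * poly (pderiv q) z"
        unfolding p by (simp add: pderiv_pCons pderiv_add)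
      moreover have "z \<noteq> 0"
      proof
        assume "z = 0"
        then have "poly (q + [:complex_of_real t:]) 0 = 0" using dp z by simp
        then show False using nT[of 0] by (simp add: T_def)
      qed
      ultimately have e: "poly (q + [:complex_of_real t:]) z = 0" "poly (pderiv q) z = 0" using z by auto
      show False
      proof (cases "pderiv q = 0")
        case False
        then show False using e nT[of z] by (simp add: T_def)
      next
        case True
        then obtain a where "q = [:a:]" using pderiv_eq_0_iff degree_eq_zeroE by metis
        then have "poly (q + [:complex_of_real t:]) 0 = 0" using e by simp
        then show False using nT[of 0] by (simp add: T_def)
      qed
    qed
    moreover have "poly p 4 \<noteq> 0"
    proof -
      have "poly p 4 = 4 * poly (q + [:complex_of_real t:]) 4" unfolding p by simp
      then show ?thesis using nT[of 4] by (simp add: T_def del: poly_add)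
    qed
    moreover have "\<exists>c>0. \<forall>N\<ge>1. c * (real N + 1) \<le> \<eta> N * \<bar>sin ((real N + 1) * \<theta>)\<bar>"
      if \<theta>: "0 < \<theta>" "\<theta> < pi" and r: "poly p (complex_of_real (2 - 2 * cos \<theta>)) = 0" for \<theta>
    proof -
      have "cos \<theta> < cos 0" using \<theta> by (intro cos_monotone_0_pi) auto
      then have "complex_of_real (2 - 2 * cos \<theta>) \<noteq> 0" by (simp only: of_real_eq_0_iff) simp
      then have "poly (q + [:complex_of_real t:]) (complex_of_real (2 - 2 * cos \<theta>)) = 0"
        using r unfolding p by simp
      from root[OF this] have "badly_approximable \<eta> \<theta>" using t \<theta> unfolding S2_def by fastforce
      then show ?thesis by (simp add: badly_approximable_def)
    qed
    ultimately show "bounded_below (\<lambda>_ N _. \<eta> N) (\<lambda>j. d j + complex_of_real t * lap_seq j)"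
      unfolding bounded_below_iff p_def
      using lower_bound_simple_roots[OF coeff_space_translate[OF d] _ _ \<eta> A] by blast
  qed
qed

section \<open>Linear identifications\<close>

lemma linear_identification_add:
  assumes id: "linear_identification k \<phi> V" and "x \<in> {..<k} \<rightarrow>\<^sub>E UNIV" "y \<in> {..<k} \<rightarrow>\<^sub>E UNIV"
  shows "\<phi> (\<lambda>i\<in>{..<k}. a * x i + b * y i) j = a *\<^sub>R \<phi> x j + b *\<^sub>R \<phi> y j"
  using assms unfolding linear_identification_def by blast

lemma restrict_in_PiE_UNIV: "restrict f I \<in> I \<rightarrow>\<^sub>E UNIV"
  by (simp add: PiE_iff)

text \<open>The unit vectors of the model of the Euclidean space by extensional functions.\<close>
definition unit_point :: "nat \<Rightarrow> nat \<Rightarrow> nat \<Rightarrow> real" where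
  "unit_point k i = (\<lambda>m\<in>{..<k}. if m = i then 1 else 0)"

lemma linear_identification_expand:
  assumes id: "linear_identification k \<phi> V" and x: "x \<in> {..<k} \<rightarrow>\<^sub>E UNIV"
  shows "\<phi> x j = (\<Sum>i<k. x i *\<^sub>R \<phi> (unit_point k i) j)"
proof -
  \<comment> \<open>Truncations of \<open>x\<close>, so that one coordinate is added at a time.\<close>
  define y where "y n = (\<lambda>m\<in>{..<k}. if m < n then x m else 0)" for n
  have y: "y n \<in> {..<k} \<rightarrow>\<^sub>E UNIV" for n unfolding y_def by (rule restrict_in_PiE_UNIV)
  have unit: "unit_point k i \<in> {..<k} \<rightarrow>\<^sub>E UNIV" for i
    unfolding unit_point_def by (rule restrict_in_PiE_UNIV)
  have "\<phi> (y n) j = (\<Sum>i<n. x i *\<^sub>R \<phi> (unit_point k i) j)" for n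
  proof (induction n)
    case 0
    have "y 0 = (\<lambda>m\<in>{..<k}. 0 * x m + 0 * x m)"
      unfolding y_def by (rule restrict_ext) simp
    then have "\<phi> (y 0) j = 0 *\<^sub>R \<phi> x j + 0 *\<^sub>R \<phi> x j"
      by (simp only: linear_identification_add[OF id x x])
    then show ?case by simp
  next
    case (Suc n)
    have "y (Suc n) = (\<lambda>m\<in>{..<k}. 1 * y n m + x n * unit_point k n m)"
      unfolding y_def unit_point_def by (rule restrict_ext) (auto simp: less_Suc_eq)
    then have "\<phi> (y (Suc n)) j = 1 *\<^sub>R \<phi> (y n) j + x n *\<^sub>R \<phi> (unit_point k n) j"
      by (simp only: linear_identification_add[OF id y unit])
    then show ?case using Suc.IH by simp
  qed
  moreover have "y k = x"
    using x by (auto simp: y_def fun_eq_iff PiE_iff extensional_def restrict_def)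
  ultimately show ?thesis by metis
qed

text \<open>Reduces almost everywhere statements for an arbitrary Lebesgue measure on \<open>V\<close> to a family of
  translates in \<open>V\<close> along the plane spanned by \<open>u1\<close> and \<open>u2\<close>. The map \<open>emb\<close> is the identity for
  complex coefficients and the inclusion for real ones, where a single direction suffices.\<close>
lemma AE_bounded_below_lebesgue:
  fixes V :: "(int \<Rightarrow> 'a::real_vector) set" and emb :: "'a \<Rightarrow> complex"
    and f1 f2 :: "'b::euclidean_space \<Rightarrow> real"
  assumes \<mu>: "\<mu> \<in> lebesgue_measures_on V" and emb: "linear emb"
    and V: "\<And>d. d \<in> V \<Longrightarrow> (\<lambda>j. emb (d j)) \<in> coeff_space l"
    and f: "f1 \<in> borel_measurable borel" "f2 \<in> borel_measurable borel" and u: "u1 \<in> V" "u2 \<in> V"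
    and ae: "\<And>d. d \<in> V \<Longrightarrow> AE t in lborel.
       bounded_below \<omega> (\<lambda>j. emb (d j) + emb (f1 t *\<^sub>R u1 j + f2 t *\<^sub>R u2 j))"
  shows "AE d in \<mu>. bounded_below \<omega> (\<lambda>j. emb (d j))"
proof -
  obtain k \<phi> where id: "linear_identification k \<phi> V"
    and \<mu>_eq: "\<mu> = embed_measure (completion (lborel_power k)) \<phi>"
    using \<mu> unfolding lebesgue_measures_on_def by blast
  have bij: "bij_betw \<phi> ({..<k} \<rightarrow>\<^sub>E UNIV) V" using id by (simp add: linear_identification_def)
  obtain x1 x2 where x1: "x1 \<in> {..<k} \<rightarrow>\<^sub>E UNIV" "\<phi> x1 = u1" and x2: "x2 \<in> {..<k} \<rightarrow>\<^sub>E UNIV" "\<phi> x2 = u2"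
  proof -
    have "u1 \<in> \<phi> ` ({..<k} \<rightarrow>\<^sub>E UNIV)" "u2 \<in> \<phi> ` ({..<k} \<rightarrow>\<^sub>E UNIV)"
      using u bij_betw_imp_surj_on[OF bij] by simp_all
    then show ?thesis using that by blast
  qed
  have \<phi>V: "\<phi> x \<in> V" if "x \<in> {..<k} \<rightarrow>\<^sub>E UNIV" for x
    by (rule bij_betw_apply[OF bij that])
  have "AE x in lborel_power k. bounded_below \<omega> (\<lambda>j. emb (\<phi> x j))"
  proof (rule AE_lborel_power_by_translates[where g = "\<lambda>t i. f1 t * x1 i + f2 t * x2 i"])
    show "{x \<in> space (lborel_power k). bounded_below \<omega> (\<lambda>j. emb (\<phi> x j))} \<in> sets (lborel_power k)"
    proof (rule bounded_below_measurable)
      show "(\<lambda>j. emb (\<phi> x j)) \<in> coeff_space l" if "x \<in> {..<k} \<rightarrow>\<^sub>E UNIV" for x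
        by (rule V[OF \<phi>V[OF that]])
      show "emb (\<phi> x j) = (\<Sum>i<k. of_real (x i) * emb (\<phi> (unit_point k i) j))"
        if "x \<in> {..<k} \<rightarrow>\<^sub>E UNIV" for x j
        unfolding linear_identification_expand[OF id that, of j]
        by (simp add: linear_sum[OF emb] linear_scale[OF emb] scaleR_conv_of_real)
    qed
    show "(\<lambda>t. f1 t * x1 i + f2 t * x2 i) \<in> borel_measurable borel" for i
      using f by measurable
    fix x assume x: "x \<in> {..<k} \<rightarrow>\<^sub>E (UNIV :: real set)"
    have "\<phi> (\<lambda>i\<in>{..<k}. x i + (f1 t * x1 i + f2 t * x2 i)) j = \<phi> x j + (f1 t *\<^sub>R u1 j + f2 t *\<^sub>R u2 j)" for t j
    proof -
      define y where "y = (\<lambda>i\<in>{..<k}. f1 t * x1 i + f2 t * x2 i)"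
      have y: "y \<in> {..<k} \<rightarrow>\<^sub>E UNIV" unfolding y_def by (rule restrict_in_PiE_UNIV)
      have split: "(\<lambda>i\<in>{..<k}. x i + (f1 t * x1 i + f2 t * x2 i)) = (\<lambda>i\<in>{..<k}. 1 * x i + 1 * y i)"
        by (rule restrict_ext) (simp add: y_def)
      have "\<phi> y j = f1 t *\<^sub>R u1 j + f2 t *\<^sub>R u2 j"
        unfolding y_def linear_identification_add[OF id x1(1) x2(1)] x1(2) x2(2) ..
      then show ?thesis
        unfolding split linear_identification_add[OF id x y] by simp
    qed
    then show "AE t in lborel. bounded_below \<omega> (\<lambda>j. emb (\<phi> (\<lambda>i\<in>{..<k}. x i + (f1 t * x1 i + f2 t * x2 i)) j))"
      using ae[OF \<phi>V[OF x]] by (simp add: linear_add[OF emb])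
  qed
  moreover have "inj_on \<phi> (space (completion (lborel_power k)))"
    using bij by (simp add: space_lborel_power bij_betw_def)
  ultimately show ?thesis unfolding \<mu>_eq by (simp add: AE_embed_measure' AE_completion_iff)
qed

lemma lebesgue_measures_on_space:
  assumes "\<mu> \<in> lebesgue_measures_on V"
  shows "space \<mu> = V"
proof -
  obtain k \<phi> where "linear_identification k \<phi> V" "\<mu> = embed_measure (completion (lborel_power k)) \<phi>"
    using assms unfolding lebesgue_measures_on_def by blast
  then show ?thesis
    by (simp add: space_embed_measure space_lborel_power linear_identification_def bij_betw_def)
qed

section \<open>The space of coefficients and almost sure stability\<close>

text \<open>The coefficients at \<open>1, ..., l + 1\<close> are free; symmetry and the vanishing sum determine the others.\<close>
lemma finite_dim_subspace_coeff_space: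
  "finite_dim_subspace (coeff_space l :: (int \<Rightarrow> 'a::field) set)"
proof -
  let ?s = "\<lambda>(c::'a) (f::int \<Rightarrow> 'a) j. c * f j"
  interpret M: Modules.module ?s
    by unfold_locales (auto simp: fun_eq_iff algebra_simps)
  have sub: "M.subspace (coeff_space l)"
    unfolding M.subspace_def
  proof (intro conjI ballI allI)
    show "(0 :: int \<Rightarrow> 'a) \<in> coeff_space l" by (simp add: mem_coeff_space_iff)
    fix x y :: "int \<Rightarrow> 'a" and c assume "x \<in> coeff_space l"
    show "?s c x \<in> coeff_space l" using coeff_space_linear[OF \<open>x \<in> _\<close> \<open>x \<in> _\<close>, of c 0] by simp
    assume "y \<in> coeff_space l"
    show "x + y \<in> coeff_space l"
      using coeff_space_linear[OF \<open>x \<in> _\<close> \<open>y \<in> _\<close>, of 1 1] by (simp add: plus_fun_def)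
  qed
  define e :: "nat \<Rightarrow> int \<Rightarrow> 'a" where "e m j = (if j = 0 then - 2 else if \<bar>j\<bar> = int m then 1 else 0)" for m j
  have eV: "e m \<in> coeff_space l" if m: "m \<in> {1..Suc l}" for m
  proof -
    have "(\<Sum>j=1..Suc l. e m (int j) + e m (- int j)) = (\<Sum>j=1..Suc l. if j = m then 2 else 0)"
      by (intro sum.cong) (auto simp: e_def)
    then have "(\<Sum>j\<in>{- int (Suc l)..int (Suc l)}. e m j) = 0"
      unfolding sum_symmetric_interval using m by (simp add: e_def)
    then show ?thesis using m by (auto simp: mem_coeff_space_iff e_def)
  qed
  have "M.span (e ` {1..Suc l}) = coeff_space l"
  proof
    show "M.span (e ` {1..Suc l}) \<subseteq> coeff_space l" using eV by (intro M.span_minimal sub) auto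
    show "coeff_space l \<subseteq> M.span (e ` {1..Suc l})"
    proof
      fix d :: "int \<Rightarrow> 'a" assume d: "d \<in> coeff_space l"
      have s: "d (- j) = d j" for j using d by (simp add: mem_coeff_space_iff)
      have apply_sum: "(\<Sum>m\<in>S. F m) j = (\<Sum>m\<in>S. F m j)" for S and F :: "nat \<Rightarrow> int \<Rightarrow> 'a" and j
        by (induction S rule: infinite_finite_induct) auto
      have "d = (\<Sum>m\<in>{1..Suc l}. ?s (d (int m)) (e m))"
      proof
        fix j
        show "d j = (\<Sum>m\<in>{1..Suc l}. ?s (d (int m)) (e m)) j"
        proof (cases "j = 0")
          case True
          have "d 0 + (\<Sum>m=1..Suc l. d (int m) + d (- int m)) = 0"
            using d unfolding mem_coeff_space_iff sum_symmetric_interval by blast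
          then have "d 0 = - (\<Sum>m=1..Suc l. d (int m) + d (- int m))"
            by (simp only: eq_neg_iff_add_eq_0)
          also have "\<dots> = (\<Sum>m=1..Suc l. d (int m) * e m 0)"
            unfolding sum_negf[symmetric] by (rule sum.cong[OF refl]) (simp add: s e_def)
          finally show ?thesis using True unfolding apply_sum by simp
        next
          case False
          have "(\<Sum>m\<in>{1..Suc l}. ?s (d (int m)) (e m)) j = (\<Sum>m\<in>{1..Suc l}. if m = nat \<bar>j\<bar> then d (int m) else 0)"
            unfolding apply_sum using False by (intro sum.cong) (auto simp: e_def)
          also have "\<dots> = (if nat \<bar>j\<bar> \<in> {1..Suc l} then d \<bar>j\<bar> else 0)" using False by simp
          also have "\<dots> = d \<bar>j\<bar>"
            using d False by (auto simp: mem_coeff_space_iff)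
          also have "\<dots> = d j" using s[of j] by (simp add: abs_if)
          finally show ?thesis by simp
        qed
      qed
      also have "\<dots> \<in> M.span (e ` {1..Suc l})"
        by (intro M.span_sum M.span_scale M.span_base) auto
      finally show "d \<in> M.span (e ` {1..Suc l})" .
    qed
  qed
  then show ?thesis unfolding finite_dim_subspace_def using sub by blast
qed

theorem theorem2p9:
  fixes l :: nat
  shows "finite_dim_subspace (coeff_space l :: (int \<Rightarrow> complex) set) \<and>
    finite_dim_subspace (coeff_space l :: (int \<Rightarrow> real) set) \<and>
    (\<forall>\<mu> \<in> lebesgue_measures_on (coeff_space l :: (int \<Rightarrow> complex) set).
       AE d in \<mu>. strongly_stable (\<lambda>N. D_mat N d)) \<and>
    (\<forall>\<mu> \<in> lebesgue_measures_on (coeff_space l :: (int \<Rightarrow> real) set).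
       \<forall>\<eta> :: nat \<Rightarrow> real.
         (\<forall>N\<ge>1. \<eta> N > 0) \<longrightarrow>
         (\<lambda>N. (real N + 1) / \<eta> N) summable_on {1..} \<longrightarrow>
         bdd_above ((\<lambda>N. (real N + 1)\<^sup>2 / \<eta> N) ` {1..}) \<longrightarrow>
         (AE d in \<mu>. stable_relatively (\<lambda>N. D_mat N (\<lambda>j. complex_of_real (d j))) \<eta>))"
proof (intro conjI ballI allI impI)
  show "finite_dim_subspace (coeff_space l :: (int \<Rightarrow> complex) set)"
    "finite_dim_subspace (coeff_space l :: (int \<Rightarrow> real) set)"
    by (rule finite_dim_subspace_coeff_space)+
next
  fix \<mu> assume \<mu>: "\<mu> \<in> lebesgue_measures_on (coeff_space l :: (int \<Rightarrow> complex) set)"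
  have "AE d in \<mu>. d \<in> coeff_space l"
    using lebesgue_measures_on_space[OF \<mu>] by (intro AE_I2) simp
  moreover have "AE d in \<mu>. bounded_below weight (\<lambda>j. d j)"
  proof (rule AE_bounded_below_lebesgue[where emb = "\<lambda>x. x" and ?f1.0 = Re and ?f2.0 = Im
        and ?u1.0 = lap_seq and ?u2.0 = "\<lambda>j. \<i> * lap_seq j", OF \<mu> linear_ident])
    show "Re \<in> borel_measurable borel" "Im \<in> borel_measurable borel" by measurable
    show "(\<lambda>j. \<i> * lap_seq j) \<in> coeff_space l" 
      using coeff_space_linear[OF lap_seq_in_coeff_space lap_seq_in_coeff_space, of \<i> 0 l] by simp
    fix d :: "int \<Rightarrow> complex" assume d: "d \<in> coeff_space l"
    have "Re t *\<^sub>R lap_seq j + Im t *\<^sub>R (\<i> * lap_seq j) = t * lap_seq j" for t and j :: int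
      by (subst (3) complex_eq) (simp add: scaleR_conv_of_real algebra_simps)
    then show "AE t in lborel. bounded_below weight (\<lambda>j. d j + (Re t *\<^sub>R lap_seq j + Im t *\<^sub>R (\<i> * lap_seq j)))"
      using AE_bounded_below_complex_direction[OF d] by simp
  qed (use lap_seq_in_coeff_space in auto)
  ultimately show "AE d in \<mu>. strongly_stable (\<lambda>N. D_mat N d)"
  proof eventually_elim
    fix d :: "int \<Rightarrow> complex" assume "d \<in> coeff_space l" "bounded_below weight (\<lambda>j. d j)"
    then show "strongly_stable (\<lambda>N. D_mat N d)"
      by (intro strongly_stableI) (auto simp: bounded_below_iff coeff_space_def)
  qed
next
  fix \<mu> \<eta>
  assume \<mu>: "\<mu> \<in> lebesgue_measures_on (coeff_space l :: (int \<Rightarrow> real) set)"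
    and \<eta>: "\<forall>N\<ge>1. \<eta> N > 0" and sm: "(\<lambda>N. (real N + 1) / \<eta> N) summable_on {1..}"
    and bdd: "bdd_above ((\<lambda>N. (real N + 1)\<^sup>2 / \<eta> N) ` {1..})"
  obtain A where A: "\<And>N. N \<ge> 1 \<Longrightarrow> (real N + 1)\<^sup>2 / \<eta> N \<le> A" using bdd by (auto simp: bdd_above_def)
  have A': "(real N + 1)\<^sup>2 \<le> max A 1 * \<eta> N" if "N \<ge> 1" for N
    using A[OF that] \<eta> that by (simp add: pos_divide_le_eq[symmetric] le_max_iff_disj)
  have emb: "(\<lambda>j. complex_of_real (d j)) \<in> coeff_space l" if "d \<in> coeff_space l" for d
    using that unfolding mem_coeff_space_iff by (auto simp flip: of_real_sum)
  have "AE d in \<mu>. d \<in> coeff_space l"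
    using lebesgue_measures_on_space[OF \<mu>] by (intro AE_I2) simp
  moreover have "AE d in \<mu>. bounded_below (\<lambda>_ N _. \<eta> N) (\<lambda>j. complex_of_real (d j))"
  proof (rule AE_bounded_below_lebesgue[where emb = complex_of_real and ?f1.0 = "\<lambda>t. t" and ?f2.0 = "\<lambda>_. 0"
        and ?u1.0 = lap_seq and ?u2.0 = lap_seq, OF \<mu> _ emb])
    show "linear complex_of_real" by (rule bounded_linear.linear[OF bounded_linear_of_real])
    show "(\<lambda>t. t) \<in> borel_measurable (borel :: real measure)" "(\<lambda>t. 0) \<in> borel_measurable (borel :: real measure)"
      by measurable
    fix d :: "int \<Rightarrow> real" assume d: "d \<in> coeff_space l"
    have e: "complex_of_real (t *\<^sub>R lap_seq j + 0 *\<^sub>R lap_seq j) = complex_of_real t * lap_seq j" for t and j :: int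
      by (simp add: lap_seq_def)
    show "AE t in lborel. bounded_below (\<lambda>_ N _. \<eta> N)
        (\<lambda>j. complex_of_real (d j) + complex_of_real (t *\<^sub>R lap_seq j + 0 *\<^sub>R lap_seq j))"
      unfolding e using AE_bounded_below_real_direction[OF emb[OF d] _ sm _ A'] \<eta> by simp
  qed (use lap_seq_in_coeff_space in auto)
  ultimately show "AE d in \<mu>. stable_relatively (\<lambda>N. D_mat N (\<lambda>j. complex_of_real (d j))) \<eta>"
  proof eventually_elim
    fix d :: "int \<Rightarrow> real"
    assume d: "d \<in> coeff_space l" and b: "bounded_below (\<lambda>_ N _. \<eta> N) (\<lambda>j. complex_of_real (d j))"
    show "stable_relatively (\<lambda>N. D_mat N (\<lambda>j. complex_of_real (d j))) \<eta>"
    proof (rule stable_relativelyI)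
      show "(\<lambda>j. complex_of_real (d j)) \<in> sym_seqs" using emb[OF d] by (simp add: coeff_space_def)
    qed (use \<eta> b in \<open>auto simp: bounded_below_iff\<close>)
  qed
qed

end
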